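(* Let $p$ be an odd prime and $r\ge1$. The irreducible complex characters of $K(p^r)=C(p^r)\rtimes G(p^r)$ are exactly the following: \begin{itemize} \item the $p^{r-1}(p-1)$ characters $z^j\sigma\mapsto\psi(\sigma)$ of degree $1$, for $\psi$ a character of $G(p^r)=(\mathbb{Z}/p^r\mathbb{Z})^*$; \item for each $1\le k\le r$, the $p^{r-k}$ characters $z^j\sigma\mapsto\psi(\sigma)\chi^r_k(z^j\sigma)$ of degree $p^{k-1}(p-1)$, where $\psi$ runs through a system of representatives of the cosets of the subgroup $G(p^k)^*$ (the characters of $G(p^r)$ factoring through $G(p^r)\to G(p^k)$) in the character group $G(p^r)^*$. \end{itemize} Here $\chi^r_k$ is defined, for $\beta=v_p(j)$ and $\alpha=v_p(\sigma-1)$, by $\chi^r_k(z^j\sigma)=0$ if $\alpha<k$ or $\beta<k-1$; $\chi^r_k(z^j\sigma)=-p^{k-1}$ if $k\le\alpha$ and $\beta=k-1$; $\chi^r_k(z^j\sigma)=p^{k-1}(p-1)$ if $k\le\alpha$ and $k-1<\beta$.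
   Context: $C(p^r)=\mathbb{Z}/p^r\mathbb{Z}$ and $G(p^r)=(\mathbb{Z}/p^r\mathbb{Z})^*$. $K(p^r)$ is the semidirect product whose elements are written $z^j\sigma$ with $j\in C(p^r)$, $\sigma\in G(p^r)$, and multiplication $z^i\sigma\, z^j\tau=z^{i+\sigma j}\sigma\tau$. For $x\in\mathbb{Z}/p^r\mathbb{Z}$, $v_p(x)\in\{0,\dots,r\}$ denotes the $p$-adic valuation of a representative, with $v_p(0)=r$. *)

theory Defs
  imports
    "HOL-Number_Theory.Residues"
    "HOL-Algebra.Coset"
    "Jordan_Normal_Form.VS_Connect"
begin

section \<open>Complex characters of a group\<close>

definition mat_trace :: "complex mat \<Rightarrow> complex" where
  "mat_trace A = (\<Sum>i<dim_row A. A $$ (i, i))"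

definition representation :: "('g, 'm) monoid_scheme \<Rightarrow> nat \<Rightarrow> ('g \<Rightarrow> complex mat) \<Rightarrow> bool" where
  "representation G n \<rho> \<longleftrightarrow> \<rho> \<in> hom G (units_of (ring_mat TYPE(complex) n ()))"

definition irreducible_representation ::
    "('g, 'm) monoid_scheme \<Rightarrow> nat \<Rightarrow> ('g \<Rightarrow> complex mat) \<Rightarrow> bool" where
  "irreducible_representation G n \<rho> \<longleftrightarrow> representation G n \<rho> \<and> n > 0 \<and>
     (\<forall>W. subspace class_ring W (module_vec TYPE(complex) n) \<and>
          (\<forall>g\<in>carrier G. \<forall>w\<in>W. \<rho> g *\<^sub>v w \<in> W) \<longrightarrow>
          W = {0\<^sub>v n} \<or> W = carrier_vec n)"

text \<open>Functions on a group are taken to be \<^const>\<open>extensional\<close>, that is, fixed to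
  \<^const>\<open>undefined\<close> outside the carrier, so that equality and cardinality of sets of characters
  have their usual meaning.\<close>

definition character_of :: "('g, 'm) monoid_scheme \<Rightarrow> ('g \<Rightarrow> complex mat) \<Rightarrow> 'g \<Rightarrow> complex" where
  "character_of G \<rho> = (\<lambda>g\<in>carrier G. mat_trace (\<rho> g))"

definition irreducible_characters :: "('g, 'm) monoid_scheme \<Rightarrow> ('g \<Rightarrow> complex) set" where
  "irreducible_characters G =
     {character_of G \<rho> | n \<rho>. irreducible_representation G n \<rho>}"

text \<open>The dimension of a representation is determined by its character, being the value at
  the identity.\<close>

definition char_degree :: "('g, 'm) monoid_scheme \<Rightarrow> ('g \<Rightarrow> complex) \<Rightarrow> nat" where
  "char_degree G \<chi> = (THE n. \<exists>\<rho>. representation G n \<rho> \<and> \<chi> = character_of G \<rho>)"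

text \<open>The character group \<open>G\<^sup>*\<close> of an abelian group \<open>G\<close>.\<close>

definition char_group :: "('g, 'm) monoid_scheme \<Rightarrow> ('g \<Rightarrow> complex) monoid" where
  "char_group G =
     \<lparr>carrier = hom G (units_of (class_ring :: complex ring)) \<inter> extensional (carrier G),
      monoid.mult = (\<lambda>\<phi> \<psi>. \<lambda>x\<in>carrier G. \<phi> x * \<psi> x),
      one = (\<lambda>x\<in>carrier G. 1)\<rparr>"

definition coset_representatives :: "('a, 'm) monoid_scheme \<Rightarrow> 'a set \<Rightarrow> 'a set \<Rightarrow> bool" where
  "coset_representatives A H T \<longleftrightarrow>
     T \<subseteq> carrier A \<and> (\<forall>C\<in>rcosets\<^bsub>A\<^esub> H. \<exists>!x. x \<in> T \<inter> C)"

section \<open>The groups \<open>C(p\<^sup>r)\<close>, \<open>G(p\<^sup>r)\<close> and \<open>K(p\<^sup>r)\<close>\<close>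

definition C_ring :: "nat \<Rightarrow> nat \<Rightarrow> int ring" where
  "C_ring p r = residue_ring (int p ^ r)"

definition G_group :: "nat \<Rightarrow> nat \<Rightarrow> int monoid" where
  "G_group p r = units_of (C_ring p r)"

text \<open>The pair \<open>(j, \<sigma>)\<close> stands for \<open>z\<^sup>j\<sigma>\<close>.\<close>

definition K_group :: "nat \<Rightarrow> nat \<Rightarrow> (int \<times> int) monoid" where
  "K_group p r =
     \<lparr>carrier = carrier (C_ring p r) \<times> carrier (G_group p r),
      monoid.mult = (\<lambda>(i, \<sigma>) (j, \<tau>).
        (i \<oplus>\<^bsub>C_ring p r\<^esub> (\<sigma> \<otimes>\<^bsub>C_ring p r\<^esub> j), \<sigma> \<otimes>\<^bsub>G_group p r\<^esub> \<tau>)),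
      one = (\<zero>\<^bsub>C_ring p r\<^esub>, \<one>\<^bsub>G_group p r\<^esub>)\<rparr>"

text \<open>The characters of \<open>G(p\<^sup>r)\<close> that factor through the reduction \<open>G(p\<^sup>r) \<rightarrow> G(p\<^sup>k)\<close>, for
  \<open>k \<le> r\<close>.\<close>

definition inflated_chars :: "nat \<Rightarrow> nat \<Rightarrow> nat \<Rightarrow> (int \<Rightarrow> complex) set" where
  "inflated_chars p r k =
     {\<lambda>\<sigma>\<in>carrier (G_group p r). \<phi> (\<sigma> mod int p ^ k) | \<phi>. \<phi> \<in> carrier (char_group (G_group p k))}"

definition vp :: "nat \<Rightarrow> nat \<Rightarrow> int \<Rightarrow> nat" where
  "vp p r x = (if [x = 0] (mod int p ^ r) then r else multiplicity (int p) x)"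

definition chi :: "nat \<Rightarrow> nat \<Rightarrow> nat \<Rightarrow> int \<times> int \<Rightarrow> complex" where
  "chi p r k = (\<lambda>(j, \<sigma>).
     let \<beta> = vp p r j; \<alpha> = vp p r (\<sigma> - 1) in
     if \<alpha> < k \<or> \<beta> < k - 1 then 0
     else if \<beta> = k - 1 then - (of_nat p ^ (k - 1))
     else of_nat p ^ (k - 1) * (of_nat p - 1))"

definition linear_chars :: "nat \<Rightarrow> nat \<Rightarrow> (int \<times> int \<Rightarrow> complex) set" where
  "linear_chars p r =
     (\<lambda>\<psi>. \<lambda>(j, \<sigma>)\<in>carrier (K_group p r). \<psi> \<sigma>) ` carrier (char_group (G_group p r))"

definition twisted_chars ::
    "nat \<Rightarrow> nat \<Rightarrow> nat \<Rightarrow> (int \<Rightarrow> complex) set \<Rightarrow> (int \<times> int \<Rightarrow> complex) set" where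
  "twisted_chars p r k T =
     (\<lambda>\<psi>. \<lambda>(j, \<sigma>)\<in>carrier (K_group p r). \<psi> \<sigma> * chi p r k (j, \<sigma>)) ` T"

end

theory Submission
  imports Defs "HOL-Number_Theory.Residue_Primitive_Roots"
begin

text \<open>For \<open>k \<le> r\<close> and a character \<open>\<psi>\<close> of \<open>G(p\<^sup>r)\<close>, the space with basis indexed by the units
  \<open>a\<close> modulo \<open>p\<^sup>k\<close> carries a representation in which \<open>z\<^sup>j\<close> acts diagonally by
  \<open>exp (2\<pi>iaj/p\<^sup>k)\<close> and \<open>\<sigma>\<close> permutes the basis, twisted by \<open>\<psi>\<close>. It is irreducible, since the
  diagonal characters are distinct and permuted transitively. Its character is \<open>\<psi>\<close> times the
  Ramanujan sum of \<open>j\<close> modulo \<open>p\<^sup>k\<close> if \<open>\<sigma> \<equiv> 1\<close> modulo \<open>p\<^sup>k\<close>, and \<open>0\<close> otherwise; \<open>k = 0\<close> gives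
  the linear characters and \<open>k \<ge> 1\<close> gives \<open>\<psi>\<chi>\<^sup>r\<^sub>k\<close>. The sum of these characters over all pairs
  \<open>(k, \<psi>)\<close> vanishes off the identity, so an irreducible character orthogonal to all of them would
  have degree \<open>0\<close>.\<close>

section \<open>Orthogonality of irreducible characters\<close>

lemma subspace_vec_iff:
  fixes W :: "complex vec set"
  shows "subspace class_ring W (module_vec TYPE(complex) n) \<longleftrightarrow>
     W \<subseteq> carrier_vec n \<and> 0\<^sub>v n \<in> W \<and> (\<forall>v\<in>W. \<forall>w\<in>W. v + w \<in> W) \<and> (\<forall>c. \<forall>v\<in>W. c \<cdot>\<^sub>v v \<in> W)"
  using vec_vs[where ?'a = complex, of n] vec_module[where ?'a = complex, of n]
  by (auto simp: subspace_def LinearCombinations.submodule_def module_vec_simps class_ring_simps)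

lemma representation_iff:
  assumes "group G"
  shows "representation G n \<rho> \<longleftrightarrow> (\<forall>g\<in>carrier G. \<rho> g \<in> carrier_mat n n) \<and>
     (\<forall>g\<in>carrier G. \<forall>h\<in>carrier G. \<rho> (g \<otimes>\<^bsub>G\<^esub> h) = \<rho> g * \<rho> h) \<and> \<rho> \<one>\<^bsub>G\<^esub> = 1\<^sub>m n"
    (is "?L \<longleftrightarrow> ?R")
proof -
  interpret G: group G by fact
  interpret M: semiring "ring_mat TYPE(complex) n ()" by (rule semiring_mat)
  have grp: "group (units_of (ring_mat TYPE(complex) n ()))" by (rule M.units_group)
  show ?thesis
  proof
    assume L: ?L
    then have hom: "\<rho> \<in> hom G (units_of (ring_mat TYPE(complex) n ()))"
      by (simp add: representation_def)
    have "\<rho> \<one>\<^bsub>G\<^esub> = \<one>\<^bsub>units_of (ring_mat TYPE(complex) n ())\<^esub>"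
      using hom_one[OF hom \<open>group G\<close> grp] .
    with hom show ?R
      by (auto simp: hom_def units_of_def Units_def ring_mat_simps)
  next
    assume R: ?R
    have "\<rho> g \<in> Units (ring_mat TYPE(complex) n ())" if "g \<in> carrier G" for g
      unfolding Units_def
    proof (intro CollectI conjI bexI)
      have "\<rho> (inv\<^bsub>G\<^esub> g) * \<rho> g = 1\<^sub>m n" "\<rho> g * \<rho> (inv\<^bsub>G\<^esub> g) = 1\<^sub>m n"
        using R that by (metis G.inv_closed G.l_inv, metis G.inv_closed G.r_inv)
      then show "\<rho> (inv\<^bsub>G\<^esub> g) \<otimes>\<^bsub>ring_mat TYPE(complex) n ()\<^esub> \<rho> g = \<one>\<^bsub>ring_mat TYPE(complex) n ()\<^esub>"
        "\<rho> g \<otimes>\<^bsub>ring_mat TYPE(complex) n ()\<^esub> \<rho> (inv\<^bsub>G\<^esub> g) = \<one>\<^bsub>ring_mat TYPE(complex) n ()\<^esub>"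
        by (simp_all add: ring_mat_simps)
    qed (use R that in \<open>auto simp: ring_mat_simps\<close>)
    then show ?L
      using R unfolding representation_def hom_def by (auto simp: units_of_def ring_mat_simps)
  qed
qed

lemma mat_trace_mult_comm:
  assumes "A \<in> carrier_mat n m" "B \<in> carrier_mat m n"
  shows "mat_trace (A * B) = mat_trace (B * A)"
proof -
  have "mat_trace (A * B) = (\<Sum>i<n. \<Sum>j<m. A $$ (i,j) * B $$ (j,i))"
    using assms by (auto simp: mat_trace_def scalar_prod_def atLeast0LessThan intro!: sum.cong)
  also have "\<dots> = (\<Sum>j<m. \<Sum>i<n. B $$ (j,i) * A $$ (i,j))"
    by (subst sum.swap) (simp add: mult.commute)
  also have "\<dots> = mat_trace (B * A)"
    using assms by (auto simp: mat_trace_def scalar_prod_def atLeast0LessThan intro!: sum.cong)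
  finally show ?thesis .
qed

lemma mat_trace_one: "mat_trace (1\<^sub>m n) = of_nat n"
  by (simp add: mat_trace_def)

lemma char_degree_eq:
  assumes "group G" "representation G n \<rho>"
  shows "char_degree G (character_of G \<rho>) = n"
proof -
  interpret G: group G by fact
  have val: "character_of G \<rho>' \<one>\<^bsub>G\<^esub> = of_nat m" if "representation G m \<rho>'" for m \<rho>'
    using that assms(1) by (auto simp: representation_iff character_of_def mat_trace_one)
  show ?thesis
    unfolding char_degree_def
  proof (rule the_equality)
    show "\<exists>\<rho>'. representation G n \<rho>' \<and> character_of G \<rho> = character_of G \<rho>'"
      using assms by blast
    fix m assume "\<exists>\<rho>'. representation G m \<rho>' \<and> character_of G \<rho> = character_of G \<rho>'"
    then show "m = n"
      using val[OF assms(2)] val by (metis of_nat_eq_iff)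
  qed
qed

lemma mat_eqI_mult_vec:
  fixes A B :: "complex mat"
  assumes "A \<in> carrier_mat n m" "B \<in> carrier_mat n m"
    "\<And>v. v \<in> carrier_vec m \<Longrightarrow> A *\<^sub>v v = B *\<^sub>v v"
  shows "A = B"
proof (rule eq_matI)
  fix i j assume "i < dim_row B" "j < dim_col B"
  then have ij: "i < n" "j < m" using assms by auto
  have "(A *\<^sub>v unit_vec m j) $ i = (B *\<^sub>v unit_vec m j) $ i"
    using assms(3)[of "unit_vec m j"] by simp
  then show "A $$ (i,j) = B $$ (i,j)" using ij assms(1,2) by auto
qed (use assms in auto)

lemma bijective_mat_inverse:
  fixes M :: "complex mat"
  assumes M: "M \<in> carrier_mat n m"
    and inj: "\<And>v. v \<in> carrier_vec m \<Longrightarrow> M *\<^sub>v v = 0\<^sub>v n \<Longrightarrow> v = 0\<^sub>v m"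
    and surj: "\<And>w. w \<in> carrier_vec n \<Longrightarrow> \<exists>v\<in>carrier_vec m. M *\<^sub>v v = w"
  obtains N where "N \<in> carrier_mat m n" "M * N = 1\<^sub>m n" "N * M = 1\<^sub>m m"
proof -
  have "\<forall>i. \<exists>v\<in>carrier_vec m. M *\<^sub>v v = unit_vec n i" using surj by simp
  then obtain f where f: "\<And>i. f i \<in> carrier_vec m" "\<And>i. M *\<^sub>v f i = unit_vec n i" by metis
  define N where "N = mat m n (\<lambda>(j,i). f i $ j)"
  have N: "N \<in> carrier_mat m n" by (simp add: N_def)
  have colN: "col N i = f i" if "i < n" for i
    using that f(1)[of i] by (intro eq_vecI) (auto simp: N_def)
  have MN: "M * N = 1\<^sub>m n"
  proof (rule eq_matI)
    fix i j assume "i < dim_row (1\<^sub>m n)" "j < dim_col (1\<^sub>m n)"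
    then have ij: "i < n" "j < n" by auto
    have "(M * N) $$ (i,j) = (M *\<^sub>v f j) $ i" using ij M N colN by simp
    then show "(M * N) $$ (i,j) = 1\<^sub>m n $$ (i,j)" using ij by (simp add: f unit_vec_def)
  qed (use M N in auto)
  have "N * M = 1\<^sub>m m"
  proof (rule mat_eqI_mult_vec[where n = m and m = m])
    fix v :: "complex vec" assume v: "v \<in> carrier_vec m"
    have NMv: "N * M *\<^sub>v v = N *\<^sub>v (M *\<^sub>v v)" using M N v by (simp add: assoc_mult_mat_vec[of _ m n _ m])
    have "M *\<^sub>v (N * M *\<^sub>v v - v) = M *\<^sub>v (N * M *\<^sub>v v) - M *\<^sub>v v"
      using M N v by (intro mult_minus_distrib_mat_vec) auto
    also have "M *\<^sub>v (N * M *\<^sub>v v) = (M * N) *\<^sub>v (M *\<^sub>v v)"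
      unfolding NMv using M N v by (subst assoc_mult_mat_vec[of _ n m _ n]) auto
    also have "\<dots> = M *\<^sub>v v" using M v by (simp add: MN)
    also have "M *\<^sub>v v - M *\<^sub>v v = 0\<^sub>v n" using M v by auto
    finally have "N * M *\<^sub>v v - v = 0\<^sub>v m" using M N v by (intro inj) auto
    then have "(N * M *\<^sub>v v) $ i = v $ i" if "i < m" for i
      using that v M N by (metis carrier_vecD index_minus_vec(1) index_zero_vec(1) right_minus_eq)
    then show "N * M *\<^sub>v v = 1\<^sub>m m *\<^sub>v v" using v N M by (intro eq_vecI) auto
  qed (use M N in auto)
  with N MN that show ?thesis by blast
qed

lemma schur_intertwiner:
  assumes "group G" "irreducible_representation G n \<rho>" "irreducible_representation G m \<rho>'"
    and M: "M \<in> carrier_mat n m"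
    and inter: "\<And>g. g \<in> carrier G \<Longrightarrow> \<rho> g * M = M * \<rho>' g"
    and nz: "M \<noteq> 0\<^sub>m n m"
  shows "character_of G \<rho> = character_of G \<rho>'"
proof -
  have rep: "representation G n \<rho>" "representation G m \<rho>'"
    using assms(2,3) by (auto simp: irreducible_representation_def)
  have car: "\<rho> g \<in> carrier_mat n n" "\<rho>' g \<in> carrier_mat m m" if "g \<in> carrier G" for g
    using rep that by (auto simp: representation_iff[OF assms(1)])
  have comm: "\<rho> g *\<^sub>v (M *\<^sub>v v) = M *\<^sub>v (\<rho>' g *\<^sub>v v)" if "g \<in> carrier G" "v \<in> carrier_vec m" for g v
    using inter[OF that(1)] assoc_mult_mat_vec[OF car(1)[OF that(1)] M that(2)]
      assoc_mult_mat_vec[OF M car(2)[OF that(1)] that(2)] by simp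
  let ?I = "(\<lambda>v. M *\<^sub>v v) ` carrier_vec m"
  let ?K = "{v \<in> carrier_vec m. M *\<^sub>v v = 0\<^sub>v n}"
  have Mnz: "\<exists>v\<in>carrier_vec m. M *\<^sub>v v \<noteq> 0\<^sub>v n"
  proof (rule ccontr)
    assume "\<not> ?thesis"
    then have "M = 0\<^sub>m n m" using M by (intro mat_eqI_mult_vec[of _ n m]) auto
    with nz show False by simp
  qed
  have "subspace class_ring ?I (module_vec TYPE(complex) n)"
    unfolding subspace_vec_iff
  proof (intro conjI ballI allI)
    have "M *\<^sub>v 0\<^sub>v m = 0\<^sub>v n" using M by auto
    then show "0\<^sub>v n \<in> ?I" by (metis image_eqI zero_carrier_vec)
    show "v + w \<in> ?I" if "v \<in> ?I" "w \<in> ?I" for v w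
      using that M by (auto simp: mult_add_distrib_mat_vec[symmetric])
    show "c \<cdot>\<^sub>v v \<in> ?I" if "v \<in> ?I" for c v
      using that M by (auto simp: mult_mat_vec[symmetric])
  qed (use M in auto)
  moreover have "\<forall>g\<in>carrier G. \<forall>w\<in>?I. \<rho> g *\<^sub>v w \<in> ?I"
  proof (intro ballI)
    fix g w assume g: "g \<in> carrier G" and "w \<in> ?I"
    then obtain v where v: "v \<in> carrier_vec m" "w = M *\<^sub>v v" by auto
    then have "\<rho>' g *\<^sub>v v \<in> carrier_vec m" using car(2)[OF g] by simp
    then show "\<rho> g *\<^sub>v w \<in> ?I" using comm[OF g v(1)] v(2) by (intro image_eqI[of _ _ "\<rho>' g *\<^sub>v v"]) auto
  qed
  ultimately have "?I = {0\<^sub>v n} \<or> ?I = carrier_vec n"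
    using assms(2) unfolding irreducible_representation_def by blast
  then have surj: "?I = carrier_vec n" using Mnz by blast
  have "subspace class_ring ?K (module_vec TYPE(complex) m)"
    unfolding subspace_vec_iff
    using M by (auto simp: mult_add_distrib_mat_vec mult_mat_vec)
  moreover have "\<forall>g\<in>carrier G. \<forall>w\<in>?K. \<rho>' g *\<^sub>v w \<in> ?K"
  proof (intro ballI)
    fix g w assume gw: "g \<in> carrier G" "w \<in> ?K"
    then have "M *\<^sub>v (\<rho>' g *\<^sub>v w) = \<rho> g *\<^sub>v 0\<^sub>v n" using comm[of g w] by simp
    also have "\<dots> = 0\<^sub>v n" using car(1)[OF gw(1)] by auto
    finally show "\<rho>' g *\<^sub>v w \<in> ?K" using gw car(2)[OF gw(1)] by auto
  qed
  ultimately have "?K = {0\<^sub>v m} \<or> ?K = carrier_vec m"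
    using assms(3) unfolding irreducible_representation_def by blast
  then have inj: "?K = {0\<^sub>v m}" using Mnz by blast
  obtain N where N: "N \<in> carrier_mat m n" "M * N = 1\<^sub>m n" "N * M = 1\<^sub>m m"
  proof (rule bijective_mat_inverse[OF M])
    show "v = 0\<^sub>v m" if "v \<in> carrier_vec m" "M *\<^sub>v v = 0\<^sub>v n" for v
      using that inj by blast
    show "\<exists>v\<in>carrier_vec m. M *\<^sub>v v = w" if "w \<in> carrier_vec n" for w
      using that surj by (metis (mono_tags, lifting) imageE)
  qed (use that in blast)
  have "mat_trace (\<rho> g) = mat_trace (\<rho>' g)" if g: "g \<in> carrier G" for g
  proof -
    note c = car[OF g]
    have "mat_trace (\<rho> g) = mat_trace (\<rho> g * (M * N))"
      by (simp add: N(2) right_mult_one_mat[OF c(1)])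
    also have "\<rho> g * (M * N) = M * (\<rho>' g * N)"
      by (simp only: assoc_mult_mat[OF c(1) M N(1), symmetric] inter[OF g] assoc_mult_mat[OF M c(2) N(1)])
    also have "mat_trace \<dots> = mat_trace (\<rho>' g * N * M)"
      by (rule mat_trace_mult_comm[OF M mult_carrier_mat[OF c(2) N(1)]])
    also have "\<rho>' g * N * M = \<rho>' g"
      by (simp only: assoc_mult_mat[OF c(2) N(1) M] N(3) right_mult_one_mat[OF c(2)])
    finally show ?thesis .
  qed
  then show ?thesis by (auto simp: character_of_def)
qed

lemma schur_orthogonality:
  assumes "group G" "finite (carrier G)"
    and irr: "irreducible_representation G n \<rho>" "irreducible_representation G m \<rho>'"
    and ne: "character_of G \<rho> \<noteq> character_of G \<rho>'"
  shows "(\<Sum>g\<in>carrier G. character_of G \<rho> g * character_of G \<rho>' (inv\<^bsub>G\<^esub> g)) = 0"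
proof -
  interpret G: group G by fact
  have rep: "representation G n \<rho>" "representation G m \<rho>'"
    using irr by (auto simp: irreducible_representation_def)
  have car: "\<rho> g \<in> carrier_mat n n" "\<rho>' g \<in> carrier_mat m m" if "g \<in> carrier G" for g
    using rep that by (auto simp: representation_iff[OF assms(1)])
  have mul: "\<rho> (g \<otimes>\<^bsub>G\<^esub> h) = \<rho> g * \<rho> h" "\<rho>' (g \<otimes>\<^bsub>G\<^esub> h) = \<rho>' g * \<rho>' h"
    if "g \<in> carrier G" "h \<in> carrier G" for g h
    using rep that by (auto simp: representation_iff[OF assms(1)])
  have ent: "(A * B) $$ (a,b) = (\<Sum>c<k. A $$ (a,c) * B $$ (c,b))"
    if "A \<in> carrier_mat x k" "B \<in> carrier_mat k y" "a < x" "b < y"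
    for A B :: "complex mat" and x k y a b
    using that by (auto simp: scalar_prod_def atLeast0LessThan intro!: sum.cong)
  have zero: "(\<Sum>g\<in>carrier G. \<rho> g $$ (a,i) * \<rho>' (inv\<^bsub>G\<^esub> g) $$ (l,b)) = 0"
    if il: "i < n" "l < m" and ab: "a < n" "b < m" for i l a b
  proof -
    txt \<open>This is the average of \<open>\<rho> g * E * \<rho>' (inv g)\<close> for the matrix unit \<open>E\<close> at \<open>(i, l)\<close>.\<close>
    define M where "M = mat n m (\<lambda>(a,b). \<Sum>g\<in>carrier G. \<rho> g $$ (a,i) * \<rho>' (inv\<^bsub>G\<^esub> g) $$ (l,b))"
    have M: "M \<in> carrier_mat n m" by (simp add: M_def)
    have "\<rho> h * M = M * \<rho>' h" if h: "h \<in> carrier G" for h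
    proof (rule eq_matI)
      fix a b assume "a < dim_row (M * \<rho>' h)" "b < dim_col (M * \<rho>' h)"
      then have ab: "a < n" "b < m" using M car[OF h] by auto
      have "(\<rho> h * M) $$ (a,b) = (\<Sum>c<n. \<Sum>g\<in>carrier G. \<rho> h $$ (a,c) * \<rho> g $$ (c,i) * \<rho>' (inv\<^bsub>G\<^esub> g) $$ (l,b))"
        unfolding ent[OF car(1)[OF h] M ab]
        by (intro sum.cong refl) (auto simp: M_def ab sum_distrib_left mult_ac)
      also have "\<dots> = (\<Sum>g\<in>carrier G. \<rho> (h \<otimes>\<^bsub>G\<^esub> g) $$ (a,i) * \<rho>' (inv\<^bsub>G\<^esub> g) $$ (l,b))"
        by (subst sum.swap, intro sum.cong refl)
          (simp add: mul h ent[OF car(1)[OF h] car(1) ab(1) il(1)] sum_distrib_right)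
      also have "\<dots> = (\<Sum>g\<in>carrier G. \<rho> g $$ (a,i) * \<rho>' (inv\<^bsub>G\<^esub> g \<otimes>\<^bsub>G\<^esub> h) $$ (l,b))"
      proof (rule sum.reindex_bij_witness[where i = "\<lambda>g. inv\<^bsub>G\<^esub> h \<otimes>\<^bsub>G\<^esub> g" and j = "\<lambda>g. h \<otimes>\<^bsub>G\<^esub> g"])
        fix g assume g: "g \<in> carrier G"
        show "inv\<^bsub>G\<^esub> h \<otimes>\<^bsub>G\<^esub> (h \<otimes>\<^bsub>G\<^esub> g) = g" "h \<otimes>\<^bsub>G\<^esub> (inv\<^bsub>G\<^esub> h \<otimes>\<^bsub>G\<^esub> g) = g"
          using g h by (simp_all add: G.m_assoc[symmetric])
        have "inv\<^bsub>G\<^esub> (h \<otimes>\<^bsub>G\<^esub> g) \<otimes>\<^bsub>G\<^esub> h = inv\<^bsub>G\<^esub> g"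
          using g h by (simp add: G.inv_mult_group G.m_assoc)
        then show "\<rho> (h \<otimes>\<^bsub>G\<^esub> g) $$ (a, i) * \<rho>' (inv\<^bsub>G\<^esub> (h \<otimes>\<^bsub>G\<^esub> g) \<otimes>\<^bsub>G\<^esub> h) $$ (l, b) =
           \<rho> (h \<otimes>\<^bsub>G\<^esub> g) $$ (a, i) * \<rho>' (inv\<^bsub>G\<^esub> g) $$ (l, b)" by simp
      qed (use h in auto)
      also have "\<dots> = (\<Sum>g\<in>carrier G. \<Sum>c<m. \<rho> g $$ (a,i) * \<rho>' (inv\<^bsub>G\<^esub> g) $$ (l,c) * \<rho>' h $$ (c,b))"
        by (intro sum.cong refl)
          (simp add: mul h ent[OF car(2) car(2)[OF h] il(2) ab(2)] sum_distrib_left mult_ac)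
      also have "\<dots> = (M * \<rho>' h) $$ (a,b)"
        unfolding ent[OF M car(2)[OF h] ab]
        by (subst sum.swap, intro sum.cong refl) (auto simp: M_def ab sum_distrib_right)
      finally show "(\<rho> h * M) $$ (a,b) = (M * \<rho>' h) $$ (a,b)" .
    qed (use M car[OF h] in auto)
    then have "M = 0\<^sub>m n m"
      using schur_intertwiner[OF assms(1) irr M] ne by blast
    then have "M $$ (a,b) = 0" using ab by simp
    then show ?thesis using ab by (simp add: M_def)
  qed
  have "(\<Sum>g\<in>carrier G. character_of G \<rho> g * character_of G \<rho>' (inv\<^bsub>G\<^esub> g)) =
      (\<Sum>g\<in>carrier G. \<Sum>i<n. \<Sum>l<m. \<rho> g $$ (i,i) * \<rho>' (inv\<^bsub>G\<^esub> g) $$ (l,l))"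
  proof (rule sum.cong)
    fix g assume g: "g \<in> carrier G"
    then have "dim_row (\<rho> g) = n" "dim_row (\<rho>' (inv\<^bsub>G\<^esub> g)) = m"
      using carrier_matD(1)[OF car(1)[of g]] carrier_matD(1)[OF car(2)[of "inv\<^bsub>G\<^esub> g"]] by blast+
    then show "character_of G \<rho> g * character_of G \<rho>' (inv\<^bsub>G\<^esub> g) =
        (\<Sum>i<n. \<Sum>l<m. \<rho> g $$ (i,i) * \<rho>' (inv\<^bsub>G\<^esub> g) $$ (l,l))"
      using g by (simp only: character_of_def mat_trace_def sum_product restrict_apply if_True G.inv_closed)
  qed (rule refl)
  also have "\<dots> = (\<Sum>i<n. \<Sum>g\<in>carrier G. \<Sum>l<m. \<rho> g $$ (i,i) * \<rho>' (inv\<^bsub>G\<^esub> g) $$ (l,l))"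
    by (rule sum.swap)
  also have "\<dots> = (\<Sum>i<n. \<Sum>l<m. \<Sum>g\<in>carrier G. \<rho> g $$ (i,i) * \<rho>' (inv\<^bsub>G\<^esub> g) $$ (l,l))"
    by (rule sum.cong[OF refl], rule sum.swap)
  also have "\<dots> = 0" by (simp add: zero)
  finally show ?thesis .
qed

lemma irreducible_characters_complete:
  assumes "group G" "finite (carrier G)" "finite I"
    and irr: "\<And>i. i \<in> I \<Longrightarrow> X i \<in> irreducible_characters G"
    and reg: "\<And>g. g \<in> carrier G \<Longrightarrow>
      (\<Sum>i\<in>I. c i * X i g) = (if g = \<one>\<^bsub>G\<^esub> then of_nat N else 0)"
    and N: "N > 0"
  shows "irreducible_characters G = X ` I"
proof (rule ccontr)
  interpret G: group G by fact
  assume "irreducible_characters G \<noteq> X ` I"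
  then obtain n \<rho> where \<rho>: "irreducible_representation G n \<rho>" and "character_of G \<rho> \<notin> X ` I"
    using irr by (auto simp: irreducible_characters_def)
  have orth: "(\<Sum>g\<in>carrier G. character_of G \<rho> g * X i (inv\<^bsub>G\<^esub> g)) = 0" if i: "i \<in> I" for i
  proof -
    obtain m \<rho>' where "irreducible_representation G m \<rho>'" "X i = character_of G \<rho>'"
      using irr[OF i] by (auto simp: irreducible_characters_def)
    moreover from this(2) have "character_of G \<rho> \<noteq> character_of G \<rho>'"
      using \<open>character_of G \<rho> \<notin> X ` I\<close> i by (metis image_eqI)
    ultimately show ?thesis
      using schur_orthogonality[OF assms(1,2) \<rho>, of m \<rho>'] by simp
  qed
  have rep: "representation G n \<rho>" "n > 0"
    using \<rho> by (auto simp: irreducible_representation_def)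
  have "0 = (\<Sum>i\<in>I. c i * (\<Sum>g\<in>carrier G. character_of G \<rho> g * X i (inv\<^bsub>G\<^esub> g)))"
    using orth by simp
  also have "\<dots> = (\<Sum>g\<in>carrier G. character_of G \<rho> g * (\<Sum>i\<in>I. c i * X i (inv\<^bsub>G\<^esub> g)))"
    by (simp add: sum_distrib_left mult_ac) (rule sum.swap)
  also have "\<dots> = (\<Sum>g\<in>carrier G. if g = \<one>\<^bsub>G\<^esub> then character_of G \<rho> g * of_nat N else 0)"
    by (intro sum.cong refl) (simp add: reg)
  also have "\<dots> = of_nat n * of_nat N"
    using assms(2) rep by (simp add: representation_iff[OF assms(1)] character_of_def mat_trace_one)
  finally show False using N rep by simp
qed

section \<open>Exponential sums and characters of cyclic groups\<close>

definition unit_exp :: "int \<Rightarrow> int \<Rightarrow> complex" where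
  "unit_exp N a = cis (2 * pi * of_int a / of_int N)"

lemma unit_exp_add: "unit_exp N (a + b) = unit_exp N a * unit_exp N b"
  by (simp add: unit_exp_def cis_mult add_divide_distrib distrib_left)

lemma unit_exp_power: "unit_exp N a ^ n = unit_exp N (int n * a)"
  by (simp add: unit_exp_def DeMoivre mult_ac)

lemma unit_exp_eq_1_iff:
  assumes "N > 0"
  shows "unit_exp N a = 1 \<longleftrightarrow> N dvd a"
proof
  assume "unit_exp N a = 1"
  then have "cos (2 * pi * of_int a / of_int N) = 1"
    by (simp add: unit_exp_def complex_eq_iff)
  then obtain x where "2 * pi * of_int a / of_int N = of_int x * 2 * pi"
    by (auto simp: cos_one_2pi_int)
  then have "real_of_int a = of_int (N * x)"
    using assms by (simp add: field_simps)
  then show "N dvd a" by (simp only: of_int_eq_iff dvd_triv_left)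
next
  assume "N dvd a"
  then obtain x where "a = N * x" by blast
  then have "2 * pi * of_int a / of_int N = 2 * pi * of_int x"
    using assms by simp
  then show "unit_exp N a = 1" by (simp only: unit_exp_def cis_multiple_2pi Ints_of_int)
qed

lemma unit_exp_cong:
  assumes "N > 0" "[a = b] (mod N)"
  shows "unit_exp N a = unit_exp N b"
proof -
  have "unit_exp N a = unit_exp N (a - b) * unit_exp N b"
    by (simp flip: unit_exp_add)
  then show ?thesis
    using assms unit_exp_eq_1_iff[of N "a - b"] by (simp add: cong_iff_dvd_diff)
qed

lemma unit_exp_cancel:
  assumes "c > 0"
  shows "unit_exp (c * N) (c * a) = unit_exp N a"
  using assms by (simp add: unit_exp_def mult_ac)

lemma sum_unit_exp:
  assumes "n > 0"
  shows "(\<Sum>j\<in>{0..<int n}. unit_exp (int n) (j * a)) = (if int n dvd a then of_nat n else 0)"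
proof -
  have "(\<Sum>j\<in>{0..<int n}. unit_exp (int n) (j * a)) = (\<Sum>j\<in>int ` {0..<n}. unit_exp (int n) (j * a))"
    by (simp add: image_int_atLeastLessThan)
  also have "\<dots> = (\<Sum>j<n. unit_exp (int n) a ^ j)"
    by (subst sum.reindex) (auto simp: unit_exp_power atLeast0LessThan)
  also have "\<dots> = (if int n dvd a then of_nat n else 0)"
  proof (cases "int n dvd a")
    case True
    then show ?thesis using assms by (simp add: unit_exp_eq_1_iff[THEN iffD2])
  next
    case False
    then have "unit_exp (int n) a \<noteq> 1" using assms by (simp add: unit_exp_eq_1_iff)
    moreover have "unit_exp (int n) a ^ n = 1"
      using assms by (simp add: unit_exp_power unit_exp_eq_1_iff)
    ultimately show ?thesis using False by (simp add: geometric_sum)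
  qed
  finally show ?thesis .
qed

lemma sum_roots_unity_power:
  assumes "n > 0"
  shows "(\<Sum>z\<in>{z::complex. z ^ n = 1}. z ^ i) = (if n dvd i then of_nat n else 0)"
proof -
  have "(\<Sum>z\<in>{z::complex. z ^ n = 1}. z ^ i) = (\<Sum>k<n. cis (2 * pi * real k / real n) ^ i)"
    by (rule sum.reindex_bij_betw[OF bij_betw_roots_unity[OF assms], symmetric])
  also have "\<dots> = (\<Sum>k<n. unit_exp (int n) (int k * int i))"
    by (intro sum.cong refl) (simp add: unit_exp_def DeMoivre mult_ac)
  also have "\<dots> = (\<Sum>j\<in>{0..<int n}. unit_exp (int n) (j * int i))"
    by (rule sum.reindex_bij_witness[of _ nat int]) auto
  finally show ?thesis using sum_unit_exp[OF assms, of "int i"] by simp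
qed

lemma char_group_carrier_iff:
  "\<psi> \<in> carrier (char_group G) \<longleftrightarrow> \<psi> \<in> extensional (carrier G) \<and> (\<forall>x\<in>carrier G. \<psi> x \<noteq> 0) \<and>
     (\<forall>x\<in>carrier G. \<forall>y\<in>carrier G. \<psi> (x \<otimes>\<^bsub>G\<^esub> y) = \<psi> x * \<psi> y)"
proof -
  have "Units (class_ring :: complex ring) = {x. x \<noteq> 0}"
    by (auto simp: Units_def class_ring_simps) (metis right_inverse left_inverse)
  then show ?thesis
    by (auto simp: char_group_def hom_def units_of_def class_ring_simps)
qed

lemma char_group_one:
  fixes G (structure)
  assumes "group G" "\<psi> \<in> carrier (char_group G)"
  shows "\<psi> \<one>\<^bsub>G\<^esub> = 1"
proof -
  interpret group G by fact
  have "\<psi> (\<one> \<otimes> \<one>) = \<psi> \<one> * \<psi> \<one>" "\<psi> \<one> \<noteq> 0"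
    using assms(2) unfolding char_group_carrier_iff by blast+
  then show ?thesis by simp
qed

lemma char_group_pow:
  fixes G (structure)
  assumes "group G" "\<psi> \<in> carrier (char_group G)" "g \<in> carrier G"
  shows "\<psi> (g [^]\<^bsub>G\<^esub> (i::nat)) = \<psi> g ^ i"
proof -
  interpret group G by fact
  have "\<psi> (x \<otimes> y) = \<psi> x * \<psi> y" if "x \<in> carrier G" "y \<in> carrier G" for x y
    using assms(2) that unfolding char_group_carrier_iff by blast
  then show ?thesis
    using assms(3) by (induction i) (simp_all add: char_group_one[OF assms(1,2)])
qed

lemma comm_group_char_group:
  fixes G (structure)
  assumes "group G"
  shows "comm_group (char_group G)"
proof (rule comm_groupI)
  interpret group G by fact
  have mult: "(\<lambda>x\<in>carrier G. \<phi> x * \<psi> x) = \<phi> \<otimes>\<^bsub>char_group G\<^esub> \<psi>" for \<phi> \<psi>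
    by (simp add: char_group_def)
  have one: "\<one>\<^bsub>char_group G\<^esub> = (\<lambda>x\<in>carrier G. 1)" by (simp add: char_group_def)
  show "\<phi> \<otimes>\<^bsub>char_group G\<^esub> \<psi> \<in> carrier (char_group G)"
    if "\<phi> \<in> carrier (char_group G)" "\<psi> \<in> carrier (char_group G)" for \<phi> \<psi>
    using that unfolding mult[symmetric] char_group_carrier_iff by simp
  show "\<one>\<^bsub>char_group G\<^esub> \<in> carrier (char_group G)"
    unfolding one char_group_carrier_iff by simp
  fix \<phi> assume \<phi>: "\<phi> \<in> carrier (char_group G)"
  then have ext: "\<phi> \<in> extensional (carrier G)" by (simp add: char_group_carrier_iff)
  show "\<one>\<^bsub>char_group G\<^esub> \<otimes>\<^bsub>char_group G\<^esub> \<phi> = \<phi>"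
    unfolding mult[symmetric] one by (rule extensionalityI[OF _ ext]) auto
  show "\<exists>\<psi>\<in>carrier (char_group G). \<psi> \<otimes>\<^bsub>char_group G\<^esub> \<phi> = \<one>\<^bsub>char_group G\<^esub>"
  proof (rule bexI[of _ "\<lambda>x\<in>carrier G. inverse (\<phi> x)"])
    show "(\<lambda>x\<in>carrier G. inverse (\<phi> x)) \<otimes>\<^bsub>char_group G\<^esub> \<phi> = \<one>\<^bsub>char_group G\<^esub>"
      using \<phi> unfolding mult[symmetric] one char_group_carrier_iff
      by (intro restrict_ext) simp
    show "(\<lambda>x\<in>carrier G. inverse (\<phi> x)) \<in> carrier (char_group G)"
      using \<phi> unfolding char_group_carrier_iff by simp
  qed
next
  show "\<phi> \<otimes>\<^bsub>char_group G\<^esub> \<psi> = \<psi> \<otimes>\<^bsub>char_group G\<^esub> \<phi>" for \<phi> \<psi>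
    by (simp add: char_group_def mult.commute)
  show "\<phi> \<otimes>\<^bsub>char_group G\<^esub> \<psi> \<otimes>\<^bsub>char_group G\<^esub> \<theta> = \<phi> \<otimes>\<^bsub>char_group G\<^esub> (\<psi> \<otimes>\<^bsub>char_group G\<^esub> \<theta>)" for \<phi> \<psi> \<theta>
    by (auto simp: char_group_def mult.assoc intro!: restrict_ext)
qed

lemma bij_betw_char_group_cyclic:
  fixes G (structure)
  assumes "group G" and g: "g \<in> carrier G"
    and bij: "bij_betw (\<lambda>i::nat. g [^]\<^bsub>G\<^esub> i) {..<n} (carrier G)" and n: "n > 0"
  shows "bij_betw (\<lambda>\<psi>. \<psi> g) (carrier (char_group G)) {z. z ^ n = 1}"
proof -
  interpret group G by fact
  have "Coset.order G = n" using bij_betw_same_card[OF bij] by (simp add: Coset.order_def)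
  then have gn: "g [^] n = \<one>" using pow_order_eq_1[OF g] by simp
  have modn: "g [^] i = g [^] (i mod n)" for i :: nat
  proof -
    have "g [^] (n * (i div n) + i mod n) = (g [^] n) [^] (i div n) \<otimes> g [^] (i mod n)"
      using g by (simp add: nat_pow_mult nat_pow_pow del: mult_div_mod_eq)
    then show ?thesis using g by (simp add: gn)
  qed
  define dlog where "dlog = the_inv_into {..<n} (\<lambda>i::nat. g [^] i)"
  have dlog: "dlog (g [^] i) = i mod n" for i :: nat
    unfolding dlog_def using modn[of i] bij n
    by (intro the_inv_into_f_eq) (auto simp: bij_betw_def)
  have repr: "\<exists>i. x = g [^] (i::nat)" if "x \<in> carrier G" for x
    using that bij by (auto simp: bij_betw_def)
  show ?thesis
  proof (rule bij_betw_byWitness[where f' = "\<lambda>z. \<lambda>x\<in>carrier G. z ^ dlog x"])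
    show "(\<lambda>\<psi>. \<psi> g) ` carrier (char_group G) \<subseteq> {z. z ^ n = 1}"
      using char_group_pow[OF assms(1) _ g, of _ n] char_group_one[OF assms(1)] by (auto simp: gn)
    have zmod: "z ^ (i mod n) = z ^ i" if "z ^ n = 1" for z :: complex and i
    proof -
      have "z ^ i = z ^ (n * (i div n) + i mod n)" by simp
      also have "\<dots> = z ^ (i mod n)" by (simp only: power_add power_mult that power_one mult_1)
      finally show ?thesis by simp
    qed
    show "(\<lambda>z. \<lambda>x\<in>carrier G. z ^ dlog x) ` {z. z ^ n = 1} \<subseteq> carrier (char_group G)"
    proof clarify
      fix z :: complex assume z: "z ^ n = 1"
      then have "z \<noteq> 0" using n by (auto simp: power_0_left)
      moreover have "z ^ dlog (x \<otimes> y) = z ^ dlog x * z ^ dlog y"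
        if xy: "x \<in> carrier G" "y \<in> carrier G" for x y
      proof -
        obtain i j where "x = g [^] (i::nat)" "y = g [^] (j::nat)" using repr xy by metis
        then show ?thesis
          using g by (simp add: nat_pow_mult dlog zmod[OF z] power_add)
      qed
      ultimately show "(\<lambda>x\<in>carrier G. z ^ dlog x) \<in> carrier (char_group G)"
        unfolding char_group_carrier_iff by simp
    qed
    show "\<forall>\<psi>\<in>carrier (char_group G). (\<lambda>x\<in>carrier G. \<psi> g ^ dlog x) = \<psi>"
    proof
      fix \<psi> assume \<psi>: "\<psi> \<in> carrier (char_group G)"
      then have ext: "\<psi> \<in> extensional (carrier G)" by (simp add: char_group_carrier_iff)
      have "\<psi> g ^ n = 1"
        using char_group_pow[OF assms(1) \<psi> g, of n] char_group_one[OF assms(1) \<psi>] by (simp add: gn)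
      then have "\<psi> g ^ dlog x = \<psi> x" if "x \<in> carrier G" for x
        using repr[OF that] by (auto simp: dlog zmod char_group_pow[OF assms(1) \<psi> g])
      then show "(\<lambda>x\<in>carrier G. \<psi> g ^ dlog x) = \<psi>"
        by (intro extensionalityI[OF _ ext]) auto
    qed
    show "\<forall>z\<in>{z::complex. z ^ n = 1}. (\<lambda>x\<in>carrier G. z ^ dlog x) g = z"
    proof
      fix z :: complex assume z: "z \<in> {z. z ^ n = 1}"
      have "dlog g = 1 mod n" using dlog[of 1] g by (simp only: nat_pow_eone)
      then have "z ^ dlog g = z"
        using z zmod[of z 1] by (simp only: mem_Collect_eq power_one_right)
      then show "(\<lambda>x\<in>carrier G. z ^ dlog x) g = z" using g by simp
    qed
  qed
qed

lemma sum_char_group_cyclic: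
  fixes G (structure)
  assumes "group G" and g: "g \<in> carrier G"
    and bij: "bij_betw (\<lambda>i::nat. g [^]\<^bsub>G\<^esub> i) {..<n} (carrier G)" and n: "n > 0"
    and x: "x \<in> carrier G"
  shows "(\<Sum>\<psi>\<in>carrier (char_group G). \<psi> x) = (if x = \<one>\<^bsub>G\<^esub> then of_nat n else 0)"
proof -
  interpret group G by fact
  obtain i where i: "i < n" "x = g [^] i" using bij x by (auto simp: bij_betw_def)
  have "(\<Sum>\<psi>\<in>carrier (char_group G). \<psi> x) = (\<Sum>\<psi>\<in>carrier (char_group G). \<psi> g ^ i)"
    using i by (intro sum.cong refl) (simp add: char_group_pow[OF assms(1) _ g])
  also have "\<dots> = (\<Sum>z\<in>{z. z ^ n = 1}. z ^ i)"
    by (rule sum.reindex_bij_betw[OF bij_betw_char_group_cyclic[OF assms(1-4)]])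
  also have "\<dots> = (if n dvd i then of_nat n else 0)"
    by (rule sum_roots_unity_power[OF n])
  also have "n dvd i \<longleftrightarrow> i = 0" using i by (auto dest: dvd_imp_le)
  also have "i = 0 \<longleftrightarrow> x = \<one>"
  proof
    assume "x = \<one>"
    then have "g [^] i = g [^] (0::nat)" using i by simp
    then show "i = 0" using bij i n by (metis bij_betw_imp_inj_on inj_onD lessThan_iff)
  qed (use i in auto)
  finally show ?thesis .
qed

section \<open>Ramanujan sums and unit groups modulo prime powers\<close>

definition coprime_residues :: "nat \<Rightarrow> nat \<Rightarrow> int set" where
  "coprime_residues p k = {a \<in> {0..<int p ^ k}. coprime a (int p ^ k)}"

definition ramanujan_sum :: "nat \<Rightarrow> nat \<Rightarrow> int \<Rightarrow> complex" where
  "ramanujan_sum p k j = (\<Sum>a\<in>coprime_residues p k. unit_exp (int p ^ k) (a * j))"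

lemma finite_coprime_residues [simp]: "finite (coprime_residues p k)"
  unfolding coprime_residues_def by (rule finite_Collect_conjI) simp

lemma coprime_residues_0 [simp]: "coprime_residues p 0 = {0}"
  by (auto simp: coprime_residues_def)

lemma cong_coprime_residues_iff:
  assumes "a \<in> coprime_residues p k" "b \<in> coprime_residues p k"
  shows "[a = b] (mod int p ^ k) \<longleftrightarrow> a = b"
  using assms by (auto simp: coprime_residues_def cong_def)

lemma ramanujan_sum_0 [simp]: "ramanujan_sum p 0 j = 1"
  by (simp add: ramanujan_sum_def unit_exp_def)

context
  fixes p :: nat
  assumes p: "prime p"
begin

lemma ramanujan_sum_Suc:
  "ramanujan_sum p (Suc k) j =
     (if int p ^ Suc k dvd j then of_nat p ^ Suc k else 0) - (if int p ^ k dvd j then of_nat p ^ k else 0)"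
proof -
  have p0: "p > 0" using p prime_gt_0_nat by blast
  have full: "(\<Sum>a\<in>{0..<int p ^ n}. unit_exp (int p ^ n) (a * j)) =
      (if int p ^ n dvd j then of_nat p ^ n else 0)" for n
    using sum_unit_exp[of "p ^ n" j] p0 by simp
  have cop: "coprime a (int p ^ Suc k) \<longleftrightarrow> \<not> int p dvd a" for a
    using prime_imp_coprime_int[of "int p" a] p by (auto simp: coprime_commute coprime_absorb_left dest: not_prime_unit)
  have split: "{0..<int p ^ Suc k} = coprime_residues p (Suc k) \<union> (\<lambda>a. int p * a) ` {0..<int p ^ k}"
  proof (rule Set.set_eqI)
    fix x
    have "int p dvd x \<and> x \<in> {0..<int p ^ Suc k} \<longleftrightarrow> x \<in> (\<lambda>a. int p * a) ` {0..<int p ^ k}"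
      using p0 by (auto simp: zero_le_mult_iff)
    then show "x \<in> {0..<int p ^ Suc k} \<longleftrightarrow>
        x \<in> coprime_residues p (Suc k) \<union> (\<lambda>a. int p * a) ` {0..<int p ^ k}"
      unfolding coprime_residues_def cop by blast
  qed
  have "(\<Sum>a\<in>{0..<int p ^ Suc k}. unit_exp (int p ^ Suc k) (a * j)) =
      ramanujan_sum p (Suc k) j + (\<Sum>a\<in>(\<lambda>a. int p * a) ` {0..<int p ^ k}. unit_exp (int p ^ Suc k) (a * j))"
    unfolding split ramanujan_sum_def
  proof (rule sum.union_disjoint)
    show "coprime_residues p (Suc k) \<inter> (\<lambda>a. int p * a) ` {0..<int p ^ k} = {}"
      unfolding coprime_residues_def cop by auto
  qed simp_all
  also have "(\<Sum>a\<in>(\<lambda>a. int p * a) ` {0..<int p ^ k}. unit_exp (int p ^ Suc k) (a * j)) =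
      (\<Sum>a\<in>{0..<int p ^ k}. unit_exp (int p ^ k) (a * j))"
    using p0 by (subst sum.reindex) (auto simp: inj_on_def unit_exp_cancel mult.assoc)
  finally show ?thesis by (simp only: full) simp
qed

lemma sum_ramanujan_sum:
  "(\<Sum>k\<le>r. ramanujan_sum p k j) = (if int p ^ r dvd j then of_nat p ^ r else 0)"
  by (induction r) (simp_all add: ramanujan_sum_Suc)

lemma vp_ge_iff:
  assumes "k \<le> r"
  shows "k \<le> vp p r x \<longleftrightarrow> int p ^ k dvd x"
proof (cases "[x = 0] (mod int p ^ r)")
  case True
  then have "int p ^ r dvd x" by (simp add: cong_0_iff)
  then show ?thesis using True assms by (auto simp: vp_def intro: power_le_dvd)
next
  case False
  then have "x \<noteq> 0" by auto
  moreover have "\<not> is_unit (int p)" using p by (auto dest: not_prime_unit)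
  ultimately show ?thesis using False by (simp add: vp_def power_dvd_iff_le_multiplicity)
qed

lemma chi_eq_ramanujan_sum:
  assumes "1 \<le> k" "k \<le> r"
  shows "chi p r k (j, \<sigma>) = (if int p ^ k dvd \<sigma> - 1 then ramanujan_sum p k j else 0)"
proof -
  obtain m where k: "k = Suc m" using assms(1) by (cases k) auto
  have "vp p r j < k - 1 \<longleftrightarrow> \<not> int p ^ m dvd j" "vp p r j \<ge> k \<longleftrightarrow> int p ^ Suc m dvd j"
    using vp_ge_iff[of m r j] vp_ge_iff[of k r j] assms k by auto
  moreover have "vp p r (\<sigma> - 1) < k \<longleftrightarrow> \<not> int p ^ k dvd \<sigma> - 1"
    using vp_ge_iff[of k r "\<sigma> - 1"] assms by auto
  moreover have "int p ^ Suc m dvd j \<Longrightarrow> int p ^ m dvd j"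
    by (rule power_le_dvd) auto
  ultimately show ?thesis
    unfolding k by (auto simp: chi_def Let_def ramanujan_sum_Suc algebra_simps)
qed

context
  fixes k :: nat
  assumes k: "k \<ge> 1"
begin

lemma one_less_prime_power: "int p ^ k > 1"
  using k prime_gt_1_nat[OF p] by (intro one_less_power) auto

lemma carrier_G_group: "carrier (G_group p k) = coprime_residues p k"
proof -
  interpret residues "int p ^ k" "residue_ring (int p ^ k)"
    by unfold_locales (rule one_less_prime_power)
  have "\<not> coprime 0 (int p ^ k)" using k prime_gt_1_nat[OF p] by simp
  then have "0 < x \<and> x < int p ^ k \<and> coprime x (int p ^ k) \<longleftrightarrow>
      x \<in> {0..<int p ^ k} \<and> coprime x (int p ^ k)" for x
    unfolding atLeastLessThan_iff order_less_le[of 0 x] by metis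
  then show ?thesis
    unfolding G_group_def C_ring_def units_of_carrier res_units_eq coprime_residues_def
    by (simp only:)
qed

lemma G_group_mult: "x \<otimes>\<^bsub>G_group p k\<^esub> y = x * y mod int p ^ k"
  by (simp add: G_group_def units_of_def C_ring_def residue_ring_def)

lemma G_group_one: "\<one>\<^bsub>G_group p k\<^esub> = 1"
  by (simp add: G_group_def units_of_def C_ring_def residue_ring_def)

lemma group_G_group: "group (G_group p k)"
proof -
  interpret residues "int p ^ k" "residue_ring (int p ^ k)"
    by unfold_locales (rule one_less_prime_power)
  show ?thesis unfolding G_group_def C_ring_def by (rule units_group)
qed

lemma coprime_residues_eq_totatives: "coprime_residues p k = int ` totatives (p ^ k)"
proof -
  have nc: "\<not> coprime 0 (int p ^ k)" "\<not> coprime (p ^ k) (p ^ k)"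
    using k prime_gt_1_nat[OF p] by auto
  show ?thesis
  proof (intro equalityI subsetI)
    fix x assume "x \<in> coprime_residues p k"
    then have x: "0 \<le> x" "x < int (p ^ k)" "coprime x (int (p ^ k))"
      by (simp_all add: coprime_residues_def)
    then obtain n where n: "x = int n" using nonneg_int_cases by blast
    have "n > 0" using x(3) nc(1) by (cases "n = 0") (simp_all add: n)
    then have "n \<in> totatives (p ^ k)"
      using x unfolding n totatives_def coprime_int_iff by simp
    then show "x \<in> int ` totatives (p ^ k)" using n by blast
  next
    fix x assume "x \<in> int ` totatives (p ^ k)"
    then obtain n where n: "x = int n" "n \<le> p ^ k" "coprime n (p ^ k)" by (auto simp: totatives_def)
    then have "n < p ^ k" using nc(2) by (metis le_neq_implies_less)
    then have "0 \<le> int n" "int n < int (p ^ k)" "coprime (int n) (int (p ^ k))"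
      using n by (simp_all only: coprime_int_iff of_nat_less_iff of_nat_0_le_iff)
    then show "x \<in> coprime_residues p k" by (simp add: n(1) coprime_residues_def)
  qed
qed

lemma card_coprime_residues: "card (coprime_residues p k) = p ^ (k - 1) * (p - 1)"
proof -
  have "card (coprime_residues p k) = totient (p ^ k)"
    unfolding coprime_residues_eq_totatives by (simp add: card_image totient_def)
  then show ?thesis using totient_prime_power[OF p] k by simp
qed

lemma G_group_generator:
  assumes "odd p"
  obtains g where "g \<in> carrier (G_group p k)"
    "bij_betw (\<lambda>i::nat. g [^]\<^bsub>G_group p k\<^esub> i) {..<p ^ (k - 1) * (p - 1)} (carrier (G_group p k))"
proof -
  interpret G: group "G_group p k" by (rule group_G_group)
  obtain h where "\<forall>k>0. residue_primroot (p ^ k) h"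
    using residue_primroot_odd_prime_power_exists[OF p assms] .
  then have h: "residue_primroot (p ^ k) h" using k by simp
  define g where "g = int (h mod p ^ k)"
  have "coprime (p ^ k) h" using h by (simp add: residue_primroot_def)
  have gt: "p ^ k > 1" using k prime_gt_1_nat[OF p] by (intro one_less_power) auto
  then have "bij_betw (\<lambda>i. h ^ i mod p ^ k) {..<totient (p ^ k)} (totatives (p ^ k))"
    by (rule residue_primroot_is_generator[OF _ h])
  moreover have "totient (p ^ k) = p ^ (k - 1) * (p - 1)"
    using totient_prime_power[OF p] k by simp
  ultimately have bij: "bij_betw (int \<circ> (\<lambda>i. h ^ i mod p ^ k)) {..<p ^ (k - 1) * (p - 1)} (carrier (G_group p k))"
    unfolding carrier_G_group coprime_residues_eq_totatives
    by (intro bij_betw_trans[of _ _ "totatives (p ^ k)"]) (auto intro!: inj_on_imp_bij_betw)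
  have pow: "g [^]\<^bsub>G_group p k\<^esub> i = (int \<circ> (\<lambda>i. h ^ i mod p ^ k)) i" for i :: nat
  proof (induction i)
    case 0
    have "(1::nat) mod p ^ k = 1" by (rule mod_less[OF gt])
    then show ?case by (simp add: G_group_one)
  next
    case (Suc i)
    then show ?case
      by (simp add: G_group_mult g_def of_nat_mod mod_simps mult.commute)
  qed
  have "p ^ k \<noteq> 0" using gt by linarith
  then have "coprime (h mod p ^ k) (p ^ k)"
    using \<open>coprime (p ^ k) h\<close> by (metis coprime_commute coprime_mod_left_iff)
  then have "coprime (int (h mod p ^ k)) (int (p ^ k))" by (simp only: coprime_int_iff)
  moreover have "int (h mod p ^ k) < int (p ^ k)"
    using \<open>p ^ k \<noteq> 0\<close> by (simp only: of_nat_less_iff mod_less_divisor neq0_conv)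
  ultimately have "g \<in> carrier (G_group p k)"
    unfolding carrier_G_group coprime_residues_def g_def
    by (simp only: of_nat_power mem_Collect_eq atLeastLessThan_iff of_nat_0_le_iff simp_thms)
  moreover have "bij_betw (\<lambda>i::nat. g [^]\<^bsub>G_group p k\<^esub> i) {..<p ^ (k - 1) * (p - 1)} (carrier (G_group p k))"
    using bij unfolding pow by (simp add: comp_def)
  ultimately show ?thesis by (rule that)
qed

lemma card_char_group_G_group:
  assumes "odd p"
  shows "card (carrier (char_group (G_group p k))) = p ^ (k - 1) * (p - 1)"
proof -
  obtain g where g: "g \<in> carrier (G_group p k)"
    "bij_betw (\<lambda>i::nat. g [^]\<^bsub>G_group p k\<^esub> i) {..<p ^ (k - 1) * (p - 1)} (carrier (G_group p k))"
    using G_group_generator[OF assms] .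
  have pos: "p ^ (k - 1) * (p - 1) > 0" using p prime_gt_1_nat[OF p] by simp
  show ?thesis
    using bij_betw_same_card[OF bij_betw_char_group_cyclic[OF group_G_group g pos]]
      card_roots_unity_eq[OF pos] by simp
qed

lemma sum_char_group_G_group:
  assumes "odd p" "x \<in> carrier (G_group p k)"
  shows "(\<Sum>\<psi>\<in>carrier (char_group (G_group p k)). \<psi> x) =
     (if x = 1 then of_nat (p ^ (k - 1) * (p - 1)) else 0)"
proof -
  obtain g where g: "g \<in> carrier (G_group p k)"
    "bij_betw (\<lambda>i::nat. g [^]\<^bsub>G_group p k\<^esub> i) {..<p ^ (k - 1) * (p - 1)} (carrier (G_group p k))"
    using G_group_generator[OF assms(1)] .
  have pos: "p ^ (k - 1) * (p - 1) > 0" using p prime_gt_1_nat[OF p] by simp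
  show ?thesis
    using sum_char_group_cyclic[OF group_G_group g pos assms(2)] by (simp add: G_group_one)
qed

lemma carrier_K_group: "carrier (K_group p k) = {0..<int p ^ k} \<times> coprime_residues p k"
  unfolding K_group_def C_ring_def residue_ring_def partial_object.simps carrier_G_group
  by (simp add: atLeastLessThanPlusOne_atLeastAtMost_int[symmetric])

lemma K_group_mult:
  "(i, \<sigma>) \<otimes>\<^bsub>K_group p k\<^esub> (j, \<tau>) = ((i + \<sigma> * j) mod int p ^ k, \<sigma> * \<tau> mod int p ^ k)"
  by (simp add: K_group_def C_ring_def residue_ring_def G_group_mult mod_add_right_eq)

lemma K_group_one: "\<one>\<^bsub>K_group p k\<^esub> = (0, 1)"
  by (simp add: K_group_def C_ring_def residue_ring_def G_group_one)

lemma group_K_group: "group (K_group p k)"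
proof (rule groupI)
  interpret G: group "G_group p k" by (rule group_G_group)
  have gt: "1 < int p ^ k" "0 < int p ^ k" using one_less_prime_power by linarith+
  have modl: "(u + v mod m * w) mod m = (u + v * w) mod m" for u v w m :: int
    by (metis mod_add_right_eq mod_mult_left_eq)
  have modr: "(u + v * (w mod m)) mod m = (u + v * w) mod m" for u v w m :: int
    by (metis mod_add_right_eq mod_mult_right_eq)
  have closed: "\<sigma> * \<tau> mod int p ^ k \<in> coprime_residues p k"
    if "\<sigma> \<in> coprime_residues p k" "\<tau> \<in> coprime_residues p k" for \<sigma> \<tau>
    using G.m_closed[of \<sigma> \<tau>] that by (simp add: carrier_G_group G_group_mult)
  show "x \<otimes>\<^bsub>K_group p k\<^esub> y \<in> carrier (K_group p k)"
    if "x \<in> carrier (K_group p k)" "y \<in> carrier (K_group p k)" for x y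
    using that closed pos_mod_bound[OF gt(2)] pos_mod_sign[OF gt(2)]
    by (auto simp: carrier_K_group K_group_mult)
  show "\<one>\<^bsub>K_group p k\<^esub> \<in> carrier (K_group p k)"
    using gt by (simp add: carrier_K_group K_group_one coprime_residues_def)
  show "x \<otimes>\<^bsub>K_group p k\<^esub> y \<otimes>\<^bsub>K_group p k\<^esub> z = x \<otimes>\<^bsub>K_group p k\<^esub> (y \<otimes>\<^bsub>K_group p k\<^esub> z)" for x y z
    by (cases x; cases y; cases z)
      (simp only: K_group_mult prod.inject mod_add_left_eq mod_mult_left_eq mod_mult_right_eq modl modr,
        simp add: algebra_simps)
  fix x assume "x \<in> carrier (K_group p k)"
  then obtain j \<sigma> where x: "x = (j, \<sigma>)" "j \<in> {0..<int p ^ k}" "\<sigma> \<in> coprime_residues p k"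
    by (auto simp: carrier_K_group)
  then show "\<one>\<^bsub>K_group p k\<^esub> \<otimes>\<^bsub>K_group p k\<^esub> x = x"
    by (simp add: K_group_mult K_group_one coprime_residues_def)
  define \<tau> where "\<tau> = inv\<^bsub>G_group p k\<^esub> \<sigma>"
  have \<tau>: "\<tau> \<in> coprime_residues p k" "\<tau> * \<sigma> mod int p ^ k = 1"
    using G.l_inv[of \<sigma>] G.inv_closed[of \<sigma>] x(3)
    by (simp_all add: \<tau>_def carrier_G_group G_group_mult G_group_one)
  show "\<exists>y\<in>carrier (K_group p k). y \<otimes>\<^bsub>K_group p k\<^esub> x = \<one>\<^bsub>K_group p k\<^esub>"
  proof (rule bexI[of _ "(- (\<tau> * j) mod int p ^ k, \<tau>)"])
    show "(- (\<tau> * j) mod int p ^ k, \<tau>) \<otimes>\<^bsub>K_group p k\<^esub> x = \<one>\<^bsub>K_group p k\<^esub>"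
      using \<tau> by (simp add: x(1) K_group_mult K_group_one mod_simps)
    show "(- (\<tau> * j) mod int p ^ k, \<tau>) \<in> carrier (K_group p k)"
      using \<tau> pos_mod_bound[OF gt(2)] pos_mod_sign[OF gt(2)] by (simp add: carrier_K_group)
  qed
qed

end

end

section \<open>The monomial representations\<close>

definition monomial_rep ::
    "nat \<Rightarrow> nat \<Rightarrow> nat \<Rightarrow> (nat \<Rightarrow> int) \<Rightarrow> (int \<Rightarrow> complex) \<Rightarrow> int \<times> int \<Rightarrow> complex mat" where
  "monomial_rep p k d a \<psi> = (\<lambda>(j, \<sigma>). mat d d (\<lambda>(i, l).
     if [\<sigma> * a i = a l] (mod int p ^ k) then \<psi> \<sigma> * unit_exp (int p ^ k) (a i * j) else 0))"

lemma subspace_eq_carrier_vecI: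
  fixes W :: "complex vec set"
  assumes W: "subspace class_ring W (module_vec TYPE(complex) n)"
    and unit: "\<And>i. i < n \<Longrightarrow> unit_vec n i \<in> W"
  shows "W = carrier_vec n"
proof
  note W' = W[unfolded subspace_vec_iff]
  show "W \<subseteq> carrier_vec n" using W' by blast
  show "carrier_vec n \<subseteq> W"
  proof
    fix v :: "complex vec" assume v: "v \<in> carrier_vec n"
    have "vec n (\<lambda>i. if i < m then v $ i else 0) \<in> W" if "m \<le> n" for m
      using that
    proof (induction m)
      case 0
      have "vec n (\<lambda>i. if i < 0 then v $ i else 0) = 0\<^sub>v n" by (intro eq_vecI) auto
      then show ?case using W' by simp
    next
      case (Suc m)
      have "vec n (\<lambda>i. if i < Suc m then v $ i else 0) =
          vec n (\<lambda>i. if i < m then v $ i else 0) + v $ m \<cdot>\<^sub>v unit_vec n m"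
        using Suc.prems by (intro eq_vecI) (auto simp: unit_vec_def less_Suc_eq)
      moreover have "v $ m \<cdot>\<^sub>v unit_vec n m \<in> W" using W' unit[of m] Suc.prems by simp
      ultimately show ?case using W' Suc by simp
    qed
    from this[of n] have "vec n (\<lambda>i. if i < n then v $ i else 0) \<in> W" by simp
    also have "vec n (\<lambda>i. if i < n then v $ i else 0) = v" using v by (intro eq_vecI) auto
    finally show "v \<in> W" .
  qed
qed

lemma subspace_sum_closed:
  fixes W :: "complex vec set"
  assumes W: "subspace class_ring W (module_vec TYPE(complex) n)"
    and "finite J" and "\<And>j. j \<in> J \<Longrightarrow> vec n (f j) \<in> W"
  shows "vec n (\<lambda>i. \<Sum>j\<in>J. f j i) \<in> W"
  using assms(2,3)
proof (induction J rule: finite_induct)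
  case empty
  have "vec n (\<lambda>i. \<Sum>j\<in>{}. f j i) = 0\<^sub>v n" by (intro eq_vecI) auto
  then show ?case using W by (simp add: subspace_vec_iff)
next
  case (insert x J)
  have "vec n (\<lambda>i. \<Sum>j\<in>insert x J. f j i) = vec n (f x) + vec n (\<lambda>i. \<Sum>j\<in>J. f j i)"
    using insert.hyps by (intro eq_vecI) auto
  then show ?case using W insert by (simp add: subspace_vec_iff)
qed

lemma cong_mult_coprime_cancel:
  fixes x y :: int
  assumes "coprime x m"
  shows "[x * y = x * z] (mod m) \<longleftrightarrow> [y = z] (mod m)"
  using cong_mult_lcancel[of x m y z] assms by simp

lemma coprime_residues_coprime:
  assumes "k \<le> r" "\<sigma> \<in> coprime_residues p r"
  shows "coprime \<sigma> (int p ^ k)"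
proof -
  have "coprime \<sigma> (int p ^ r)" using assms by (simp add: coprime_residues_def)
  then show ?thesis by (rule coprime_divisors[OF dvd_refl le_imp_power_dvd[OF assms(1)]])
qed

context
  fixes p r k d :: nat and a :: "nat \<Rightarrow> int" and \<psi> :: "int \<Rightarrow> complex"
  assumes p: "prime p" and r: "r \<ge> 1" and kr: "k \<le> r"
    and a: "bij_betw a {..<d} (coprime_residues p k)"
    and \<psi>: "\<psi> \<in> carrier (char_group (G_group p r))"
begin

lemma index_residue: "i < d \<Longrightarrow> a i \<in> coprime_residues p k"
  using a by (auto simp: bij_betw_def)

lemma index_cong_iff: "i < d \<Longrightarrow> l < d \<Longrightarrow> [a i = a l] (mod int p ^ k) \<longleftrightarrow> i = l"
  using a cong_coprime_residues_iff[OF index_residue index_residue]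
  by (auto simp: bij_betw_def dest: inj_onD)

lemma index_coprime: "i < d \<Longrightarrow> coprime (a i) (int p ^ k)"
  using index_residue by (simp add: coprime_residues_def)

lemma modulus_dvd: "int p ^ k dvd int p ^ r"
  using kr by (rule le_imp_power_dvd)

lemma modulus_pos: "int p ^ k > 0"
  using prime_gt_0_nat[OF p] by simp

lemma index_of_coprime:
  assumes "coprime x (int p ^ k)"
  obtains l where "l < d" "[x = a l] (mod int p ^ k)"
proof -
  have "x mod int p ^ k \<in> coprime_residues p k"
    using assms modulus_pos pos_mod_bound[OF modulus_pos] pos_mod_sign[OF modulus_pos]
    unfolding coprime_residues_def mem_Collect_eq
    by (metis atLeastLessThan_iff coprime_mod_left_iff less_irrefl)
  then obtain l where "l < d" "a l = x mod int p ^ k"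
    using a by (metis bij_betw_imp_surj_on imageE lessThan_iff)
  then show ?thesis using that by (metis cong_mod_right cong_refl)
qed

lemma psi_mult:
  assumes "\<sigma> \<in> coprime_residues p r" "\<tau> \<in> coprime_residues p r"
  shows "\<psi> (\<sigma> * \<tau> mod int p ^ r) = \<psi> \<sigma> * \<psi> \<tau>"
proof -
  have "\<psi> (\<sigma> \<otimes>\<^bsub>G_group p r\<^esub> \<tau>) = \<psi> \<sigma> * \<psi> \<tau>"
    using \<psi> assms unfolding char_group_carrier_iff carrier_G_group[OF p r] by blast
  then show ?thesis by (simp add: G_group_mult[OF p r])
qed

lemma monomial_rep_hom:
  assumes s: "\<sigma> \<in> coprime_residues p r" and t: "\<tau> \<in> coprime_residues p r"
  shows "monomial_rep p k d a \<psi> ((j + \<sigma> * j') mod int p ^ r, \<sigma> * \<tau> mod int p ^ r) =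
     monomial_rep p k d a \<psi> (j, \<sigma>) * monomial_rep p k d a \<psi> (j', \<tau>)" (is "?L = ?A * ?B")
proof (rule eq_matI)
  let ?q = "int p ^ k"
  fix i l assume "i < dim_row (?A * ?B)" "l < dim_col (?A * ?B)"
  then have il: "i < d" "l < d" by (simp_all add: monomial_rep_def)
  have "coprime (\<sigma> * a i) ?q" using coprime_residues_coprime[OF kr s] index_coprime[OF il(1)] by (simp only: coprime_mult_left_iff)
  then obtain m where m: "m < d" "[\<sigma> * a i = a m] (mod ?q)" by (rule index_of_coprime)
  have uniq: "[\<sigma> * a i = a n] (mod ?q) \<longleftrightarrow> n = m" if "n < d" for n
    using m index_cong_iff[OF m(1) that] by (metis cong_sym cong_trans)
  have "(?A * ?B) $$ (i, l) = (\<Sum>n<d. ?A $$ (i, n) * ?B $$ (n, l))"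
    using il by (simp add: monomial_rep_def scalar_prod_def atLeast0LessThan)
  also have "\<dots> = (\<Sum>n<d. if n = m then ?A $$ (i, m) * ?B $$ (m, l) else 0)"
    using il uniq by (intro sum.cong refl) (auto simp: monomial_rep_def)
  also have "\<dots> = ?A $$ (i, m) * ?B $$ (m, l)" using m by simp
  also have "\<dots> = (if [\<tau> * a m = a l] (mod ?q) then
       \<psi> \<sigma> * \<psi> \<tau> * (unit_exp ?q (a i * j) * unit_exp ?q (a m * j')) else 0)"
    using il m by (simp add: monomial_rep_def)
  also have "unit_exp ?q (a m * j') = unit_exp ?q (\<sigma> * a i * j')"
    using modulus_pos cong_scalar_right[OF cong_sym[OF m(2)], of j'] by (rule unit_exp_cong)
  also have "unit_exp ?q (a i * j) * unit_exp ?q (\<sigma> * a i * j') = unit_exp ?q (a i * (j + \<sigma> * j'))"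
    by (simp add: algebra_simps flip: unit_exp_add)
  also have "\<dots> = unit_exp ?q (a i * ((j + \<sigma> * j') mod int p ^ r))"
    using modulus_pos
    by (intro unit_exp_cong cong_scalar_left cong_dvd_modulus[OF _ modulus_dvd])
      (simp_all add: cong_def)
  also have "[\<tau> * a m = a l] (mod ?q) \<longleftrightarrow> [\<sigma> * \<tau> mod int p ^ r * a i = a l] (mod ?q)"
  proof -
    have "[\<tau> * a m = \<tau> * (\<sigma> * a i)] (mod ?q)" using m(2) by (intro cong_scalar_left) (rule cong_sym)
    moreover have "[\<sigma> * \<tau> mod int p ^ r = \<sigma> * \<tau>] (mod ?q)"
      by (rule cong_dvd_modulus[OF _ modulus_dvd]) (simp add: cong_def)
    then have "[\<sigma> * \<tau> mod int p ^ r * a i = \<sigma> * \<tau> * a i] (mod ?q)" by (rule cong_scalar_right)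
    ultimately have "[\<tau> * a m = \<sigma> * \<tau> mod int p ^ r * a i] (mod ?q)"
      by (metis (no_types, lifting) cong_sym cong_trans mult.assoc mult.left_commute)
    then show ?thesis by (metis cong_sym cong_trans)
  qed
  also have "(if [\<sigma> * \<tau> mod int p ^ r * a i = a l] (mod ?q) then
      \<psi> \<sigma> * \<psi> \<tau> * unit_exp ?q (a i * ((j + \<sigma> * j') mod int p ^ r)) else 0) = ?L $$ (i, l)"
    using il by (simp add: monomial_rep_def psi_mult[OF s t])
  finally show "?L $$ (i, l) = (?A * ?B) $$ (i, l)" by (rule sym)
qed (simp_all add: monomial_rep_def)

lemma representation_monomial_rep: "representation (K_group p r) d (monomial_rep p k d a \<psi>)"
  unfolding representation_iff[OF group_K_group[OF p r]]
proof (intro conjI ballI)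
  show "monomial_rep p k d a \<psi> g \<in> carrier_mat d d" for g
    by (cases g) (simp add: monomial_rep_def)
  show "monomial_rep p k d a \<psi> (g \<otimes>\<^bsub>K_group p r\<^esub> h) = monomial_rep p k d a \<psi> g * monomial_rep p k d a \<psi> h"
    if "g \<in> carrier (K_group p r)" "h \<in> carrier (K_group p r)" for g h
    using that monomial_rep_hom
    by (cases g; cases h) (simp add: carrier_K_group[OF p r] K_group_mult[OF p r])
  have "\<psi> 1 = 1"
    using char_group_one[OF group_G_group[OF p r] \<psi>] by (simp add: G_group_one[OF p r])
  then show "monomial_rep p k d a \<psi> \<one>\<^bsub>K_group p r\<^esub> = 1\<^sub>m d"
    unfolding K_group_one[OF p r]
    by (intro eq_matI) (auto simp: monomial_rep_def index_cong_iff unit_exp_def)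
qed

lemma character_monomial_rep:
  "character_of (K_group p r) (monomial_rep p k d a \<psi>) =
     (\<lambda>(j, \<sigma>)\<in>carrier (K_group p r). if int p ^ k dvd \<sigma> - 1 then \<psi> \<sigma> * ramanujan_sum p k j else 0)"
  unfolding character_of_def
proof (rule restrict_ext)
  let ?q = "int p ^ k"
  fix g assume "g \<in> carrier (K_group p r)"
  obtain j \<sigma> where g: "g = (j, \<sigma>)" by (cases g)
  have diag: "[\<sigma> * a i = a i] (mod ?q) \<longleftrightarrow> ?q dvd \<sigma> - 1" if "i < d" for i
    using cong_mult_coprime_cancel[OF index_coprime[OF that], of \<sigma> 1]
    by (simp add: cong_iff_dvd_diff mult.commute)
  have "mat_trace (monomial_rep p k d a \<psi> (j, \<sigma>)) =
      (\<Sum>i<d. if ?q dvd \<sigma> - 1 then \<psi> \<sigma> * unit_exp ?q (a i * j) else 0)"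
    unfolding mat_trace_def monomial_rep_def by (simp add: diag)
  also have "\<dots> = (if ?q dvd \<sigma> - 1 then \<psi> \<sigma> * (\<Sum>i<d. unit_exp ?q (a i * j)) else 0)"
    by (simp add: sum_distrib_left)
  also have "(\<Sum>i<d. unit_exp ?q (a i * j)) = ramanujan_sum p k j"
    unfolding ramanujan_sum_def by (rule sum.reindex_bij_betw[OF a])
  finally show "mat_trace (monomial_rep p k d a \<psi> g) =
      (case g of (j, \<sigma>) \<Rightarrow> if ?q dvd \<sigma> - 1 then \<psi> \<sigma> * ramanujan_sum p k j else 0)"
    by (simp add: g)
qed

lemma transitive_on_residues:
  assumes x: "x \<in> coprime_residues p k" and y: "y \<in> coprime_residues p k"
  obtains \<sigma> where "\<sigma> \<in> coprime_residues p r" "[\<sigma> * x = y] (mod int p ^ k)"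
proof (cases "k = 0")
  case True
  have "1 \<in> coprime_residues p r"
    using one_less_prime_power[OF p r] by (simp add: coprime_residues_def)
  then show ?thesis using that[of 1] True by simp
next
  case False
  have cop: "coprime x (int p ^ k)" "coprime y (int p ^ k)" using x y by (simp_all add: coprime_residues_def)
  obtain u where u: "[x * u = 1] (mod int p ^ k)" using cong_solve_coprime_int[OF cop(1)] by blast
  then have "coprime u (int p ^ k)"
    by (metis coprime_iff_invertible_int mult.commute)
  then have "coprime (u * y) (int p)" using cop(2) False by simp
  then have "coprime (u * y) (int p ^ r)" by simp
  moreover have pos: "int p ^ r > 0" using prime_gt_0_nat[OF p] by simp
  ultimately have mem: "u * y mod int p ^ r \<in> coprime_residues p r"
    using pos_mod_bound[OF pos] pos_mod_sign[OF pos]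
    unfolding coprime_residues_def mem_Collect_eq
    by (metis atLeastLessThan_iff coprime_mod_left_iff less_irrefl)
  have "[u * y mod int p ^ r = u * y] (mod int p ^ k)"
    by (rule cong_dvd_modulus[OF _ modulus_dvd]) (simp add: cong_def)
  then have "[u * y mod int p ^ r * x = u * y * x] (mod int p ^ k)" by (rule cong_scalar_right)
  also have "[u * y * x = 1 * y] (mod int p ^ k)"
    using cong_scalar_right[OF u, of y] by (simp add: mult_ac)
  finally show ?thesis using that[OF mem] by simp
qed

lemma irreducible_monomial_rep:
  "irreducible_representation (K_group p r) d (monomial_rep p k d a \<psi>)"
  unfolding irreducible_representation_def
proof (intro conjI allI impI)
  let ?\<rho> = "monomial_rep p k d a \<psi>" and ?q = "int p ^ k"
  show "representation (K_group p r) d ?\<rho>" by (rule representation_monomial_rep)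
  have "coprime 1 ?q" by simp
  then obtain l where "l < d" by (rule index_of_coprime)
  then show "d > 0" by simp
  fix W :: "complex vec set"
  assume W: "subspace class_ring W (module_vec TYPE(complex) d) \<and>
    (\<forall>g\<in>carrier (K_group p r). \<forall>w\<in>W. ?\<rho> g *\<^sub>v w \<in> W)"
  then have sub: "subspace class_ring W (module_vec TYPE(complex) d)"
    and inv: "\<And>g w. g \<in> carrier (K_group p r) \<Longrightarrow> w \<in> W \<Longrightarrow> ?\<rho> g *\<^sub>v w \<in> W" by blast+
  note W' = sub[unfolded subspace_vec_iff]
  have scale: "c \<cdot>\<^sub>v w \<in> W" if "w \<in> W" for c w using W' that by blast
  have one: "1 \<in> coprime_residues p r"
    using one_less_prime_power[OF p r] by (simp add: coprime_residues_def)
  have psi_nz: "\<psi> \<sigma> \<noteq> 0" if "\<sigma> \<in> coprime_residues p r" for \<sigma>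
    using \<psi> that unfolding char_group_carrier_iff carrier_G_group[OF p r] by blast
  have "W = carrier_vec d" if nz: "W \<noteq> {0\<^sub>v d}"
  proof -
    obtain w where w: "w \<in> W" "w \<noteq> 0\<^sub>v d" using nz W' by blast
    then have wd: "w \<in> carrier_vec d" using W' by blast
    then obtain b where b: "b < d" "w $ b \<noteq> 0" using w(2) by (metis carrier_vecD eq_vecI index_zero_vec)
    txt \<open>Averaging \<open>z\<^sup>j\<close> against the inverse of its \<open>b\<close>-th eigenvalue isolates the \<open>b\<close>-th
      coordinate.\<close>
    have proj: "vec d (\<lambda>i. \<Sum>j\<in>{0..<?q}. unit_exp ?q (j * (a i - a b)) * w $ i) \<in> W"
    proof (rule subspace_sum_closed[OF sub])
      fix j assume j: "j \<in> {0..<?q}"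
      have "?q \<le> int p ^ r"
        by (rule zdvd_imp_le[OF modulus_dvd]) (use prime_gt_0_nat[OF p] in simp)
      then have "(j, 1) \<in> carrier (K_group p r)" using j one by (simp add: carrier_K_group[OF p r])
      from scale[OF inv[OF this w(1)]]
      have "(unit_exp ?q (- (a b * j)) / \<psi> 1) \<cdot>\<^sub>v (?\<rho> (j, 1) *\<^sub>v w) \<in> W" .
      also have "(unit_exp ?q (- (a b * j)) / \<psi> 1) \<cdot>\<^sub>v (?\<rho> (j, 1) *\<^sub>v w) =
          vec d (\<lambda>i. unit_exp ?q (j * (a i - a b)) * w $ i)"
      proof (rule eq_vecI)
        fix i assume "i < dim_vec (vec d (\<lambda>i. unit_exp ?q (j * (a i - a b)) * w $ i))"
        then have i: "i < d" by simp
        have "(?\<rho> (j, 1) *\<^sub>v w) $ i = (\<Sum>l<d. ?\<rho> (j, 1) $$ (i, l) * w $ l)"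
          using i wd by (simp add: monomial_rep_def scalar_prod_def atLeast0LessThan)
        also have "\<dots> = (\<Sum>l<d. if l = i then \<psi> 1 * unit_exp ?q (a i * j) * w $ i else 0)"
          using i by (intro sum.cong refl) (auto simp: monomial_rep_def index_cong_iff)
        also have "\<dots> = \<psi> 1 * unit_exp ?q (a i * j) * w $ i" using i by simp
        finally have "(?\<rho> (j, 1) *\<^sub>v w) $ i = \<psi> 1 * unit_exp ?q (a i * j) * w $ i" .
        moreover have "unit_exp ?q (j * (a i - a b)) = unit_exp ?q (- (a b * j)) * unit_exp ?q (a i * j)"
          by (simp add: algebra_simps flip: unit_exp_add)
        ultimately show "((unit_exp ?q (- (a b * j)) / \<psi> 1) \<cdot>\<^sub>v (?\<rho> (j, 1) *\<^sub>v w)) $ i =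
            vec d (\<lambda>i. unit_exp ?q (j * (a i - a b)) * w $ i) $ i"
          using i psi_nz[OF one] by (simp add: monomial_rep_def)
      qed (simp add: monomial_rep_def)
      finally show "vec d (\<lambda>i. unit_exp ?q (j * (a i - a b)) * w $ i) \<in> W" .
    qed simp
    have "(\<Sum>j\<in>{0..<?q}. unit_exp ?q (j * (a i - a b)) * w $ i) = (if i = b then of_nat p ^ k * w $ b else 0)"
      if "i < d" for i
    proof -
      have "p ^ k > 0" using prime_gt_0_nat[OF p] by simp
      from sum_unit_exp[OF this, of "a i - a b"] show ?thesis
        using index_cong_iff[OF that b(1)] by (simp add: cong_iff_dvd_diff flip: sum_distrib_right)
    qed
    then have "unit_vec d b = (1 / (of_nat p ^ k * w $ b)) \<cdot>\<^sub>v
        vec d (\<lambda>i. \<Sum>j\<in>{0..<?q}. unit_exp ?q (j * (a i - a b)) * w $ i)"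
      using b prime_gt_0_nat[OF p] by (intro eq_vecI) (auto simp: unit_vec_def)
    then have ub: "unit_vec d b \<in> W" using scale[OF proj] by simp
    show ?thesis
    proof (rule subspace_eq_carrier_vecI[OF sub])
      fix i assume i: "i < d"
      obtain \<sigma> where s: "\<sigma> \<in> coprime_residues p r" "[\<sigma> * a i = a b] (mod ?q)"
        using transitive_on_residues[OF index_residue[OF i] index_residue[OF b(1)]] .
      have uniq: "[\<sigma> * a l = a b] (mod ?q) \<longleftrightarrow> l = i" if "l < d" for l
      proof -
        have "[\<sigma> * a l = a b] (mod ?q) \<longleftrightarrow> [\<sigma> * a l = \<sigma> * a i] (mod ?q)"
          using s(2) by (metis cong_sym cong_trans)
        also have "\<dots> \<longleftrightarrow> l = i"
          using cong_mult_coprime_cancel[OF coprime_residues_coprime[OF kr s(1)]] index_cong_iff[OF that i] by simp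
        finally show ?thesis .
      qed
      have "(0, \<sigma>) \<in> carrier (K_group p r)"
        using s(1) prime_gt_0_nat[OF p] by (simp add: carrier_K_group[OF p r])
      from scale[OF inv[OF this ub]] have "(1 / \<psi> \<sigma>) \<cdot>\<^sub>v (?\<rho> (0, \<sigma>) *\<^sub>v unit_vec d b) \<in> W" .
      also have "(1 / \<psi> \<sigma>) \<cdot>\<^sub>v (?\<rho> (0, \<sigma>) *\<^sub>v unit_vec d b) = unit_vec d i"
        using b(1) psi_nz[OF s(1)] i
        by (intro eq_vecI) (auto simp: monomial_rep_def uniq unit_vec_def[of d i] unit_exp_def)
      finally show "unit_vec d i \<in> W" .
    qed
  qed
  then show "W = {0\<^sub>v d} \<or> W = carrier_vec d" by blast
qed

end

section \<open>The classification\<close>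

lemma coset_representatives_bij_betw:
  assumes "group A" "subgroup H A" "coset_representatives A H T"
  shows "bij_betw (\<lambda>t. H #>\<^bsub>A\<^esub> t) T (rcosets\<^bsub>A\<^esub> H)"
proof -
  interpret A: group A by fact
  have T: "T \<subseteq> carrier A" and rep: "\<And>C. C \<in> rcosets\<^bsub>A\<^esub> H \<Longrightarrow> \<exists>!x. x \<in> T \<inter> C"
    using assms(3) by (auto simp: coset_representatives_def)
  have coset: "H #>\<^bsub>A\<^esub> t \<in> rcosets\<^bsub>A\<^esub> H" if "t \<in> T" for t
    using that T assms(2) by (intro A.rcosetsI) (auto dest: subgroup.subset)
  have self: "t \<in> H #>\<^bsub>A\<^esub> t" if "t \<in> T" for t
    using that T assms(2) by (intro A.rcos_self) auto
  show ?thesis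
    unfolding bij_betw_def
  proof (intro conjI equalityI subsetI)
    show "inj_on (\<lambda>t. H #>\<^bsub>A\<^esub> t) T"
      using self rep[OF coset] by (intro inj_onI) (metis IntI)
    show "C \<in> rcosets\<^bsub>A\<^esub> H" if "C \<in> (\<lambda>t. H #>\<^bsub>A\<^esub> t) ` T" for C
      using that coset by blast
    fix C assume C: "C \<in> rcosets\<^bsub>A\<^esub> H"
    then obtain x where x: "x \<in> carrier A" "C = H #>\<^bsub>A\<^esub> x" by (auto simp: RCOSETS_def)
    obtain t where "t \<in> T" "t \<in> C" using rep[OF C] by blast
    then show "C \<in> (\<lambda>t. H #>\<^bsub>A\<^esub> t) ` T"
      using A.repr_independence[OF _ x(1) assms(2)] x(2) by blast
  qed
qed

lemma char_group_inv:
  fixes G (structure)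
  assumes "group G" "\<psi> \<in> carrier (char_group G)" "x \<in> carrier G"
  shows "(inv\<^bsub>char_group G\<^esub> \<psi>) x = inverse (\<psi> x)"
proof -
  interpret A: comm_group "char_group G" by (rule comm_group_char_group[OF assms(1)])
  have "(inv\<^bsub>char_group G\<^esub> \<psi> \<otimes>\<^bsub>char_group G\<^esub> \<psi>) x = \<one>\<^bsub>char_group G\<^esub> x"
    using assms(2) by simp
  then have "(inv\<^bsub>char_group G\<^esub> \<psi>) x * \<psi> x = 1"
    using assms(3) by (simp add: char_group_def)
  moreover have "\<psi> x \<noteq> 0" using assms by (simp add: char_group_carrier_iff)
  ultimately show ?thesis by (metis inverse_unique mult.commute)
qed

definition induced_char :: "nat \<Rightarrow> nat \<Rightarrow> nat \<Rightarrow> (int \<Rightarrow> complex) \<Rightarrow> int \<times> int \<Rightarrow> complex" where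
  "induced_char p r k \<psi> = (\<lambda>(j, \<sigma>)\<in>carrier (K_group p r).
     if int p ^ k dvd \<sigma> - 1 then \<psi> \<sigma> * ramanujan_sum p k j else 0)"

context
  fixes p r :: nat
  assumes p: "prime p" and odd: "odd p" and r: "r \<ge> 1"
begin

lemma finite_char_group_G_group: "finite (carrier (char_group (G_group p r)))"
proof -
  have "p ^ (r - 1) * (p - 1) > 0" using prime_gt_1_nat[OF p] by simp
  then show ?thesis
    using card_char_group_G_group[OF p r odd] by (metis card.infinite less_irrefl)
qed

lemma induced_char_rep:
  assumes "k \<le> r" "\<psi> \<in> carrier (char_group (G_group p r))"
  obtains \<rho> where
    "irreducible_representation (K_group p r) (card (coprime_residues p k)) \<rho>"
    "induced_char p r k \<psi> = character_of (K_group p r) \<rho>"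
proof -
  obtain a where a: "bij_betw a {..<card (coprime_residues p k)} (coprime_residues p k)"
    using ex_bij_betw_nat_finite[of "coprime_residues p k"] by (auto simp: atLeast0LessThan)
  show ?thesis
    using that irreducible_monomial_rep[OF p r assms(1) a assms(2)]
      character_monomial_rep[OF p r assms(1) a assms(2)]
    unfolding induced_char_def by metis
qed

lemma char_degree_induced_char:
  assumes "k \<le> r" "\<psi> \<in> carrier (char_group (G_group p r))"
  shows "char_degree (K_group p r) (induced_char p r k \<psi>) = card (coprime_residues p k)"
proof -
  obtain \<rho> where \<rho>: "irreducible_representation (K_group p r) (card (coprime_residues p k)) \<rho>"
    "induced_char p r k \<psi> = character_of (K_group p r) \<rho>"
    using induced_char_rep[OF assms] .
  then show ?thesis
    using char_degree_eq[OF group_K_group[OF p r]] by (simp add: irreducible_representation_def)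
qed

lemma irreducible_characters_K_group:
  "irreducible_characters (K_group p r) =
     (\<lambda>(k, \<psi>). induced_char p r k \<psi>) ` ({..r} \<times> carrier (char_group (G_group p r)))"
    (is "_ = _ ` (_ \<times> ?A)")
proof (rule irreducible_characters_complete[where c = "\<lambda>_. 1" and N = "p ^ (r - 1) * (p - 1) * p ^ r"])
  show "group (K_group p r)" by (rule group_K_group[OF p r])
  show "finite (carrier (K_group p r))" by (simp add: carrier_K_group[OF p r])
  show "finite ({..r} \<times> ?A)" using finite_char_group_G_group by simp
  show "p ^ (r - 1) * (p - 1) * p ^ r > 0" using prime_gt_1_nat[OF p] by simp
  show "(case i of (k, \<psi>) \<Rightarrow> induced_char p r k \<psi>) \<in> irreducible_characters (K_group p r)"
    if mem: "i \<in> {..r} \<times> ?A" for i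
  proof -
    obtain k \<psi> where i: "i = (k, \<psi>)" "k \<le> r" "\<psi> \<in> ?A" using mem by auto
    obtain \<rho> where "irreducible_representation (K_group p r) (card (coprime_residues p k)) \<rho>"
      "induced_char p r k \<psi> = character_of (K_group p r) \<rho>"
      using induced_char_rep[OF i(2,3)] .
    then show ?thesis unfolding irreducible_characters_def i(1) by auto
  qed
  fix g assume g: "g \<in> carrier (K_group p r)"
  then obtain j \<sigma> where js: "g = (j, \<sigma>)" "j \<in> {0..<int p ^ r}" "\<sigma> \<in> carrier (G_group p r)"
    by (auto simp: carrier_K_group[OF p r] carrier_G_group[OF p r])
  let ?n = "p ^ (r - 1) * (p - 1)"
  have "(\<Sum>i\<in>{..r} \<times> ?A. 1 * (case i of (k, \<psi>) \<Rightarrow> induced_char p r k \<psi>) g) =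
      (\<Sum>k\<le>r. \<Sum>\<psi>\<in>?A. induced_char p r k \<psi> g)"
    by (simp add: sum.cartesian_product case_prod_beta)
  also have "\<dots> = (\<Sum>k\<le>r. if int p ^ k dvd \<sigma> - 1 then (\<Sum>\<psi>\<in>?A. \<psi> \<sigma>) * ramanujan_sum p k j else 0)"
    using g by (intro sum.cong refl) (simp add: induced_char_def js(1) sum_distrib_right)
  also have "\<dots> = (if \<sigma> = 1 then of_nat ?n * (\<Sum>k\<le>r. ramanujan_sum p k j) else 0)"
    using sum_char_group_G_group[OF p r odd js(3)] by (simp add: sum_distrib_left cong: if_cong)
  also have "(\<Sum>k\<le>r. ramanujan_sum p k j) = (if j = 0 then of_nat p ^ r else 0)"
    using js(2) zdvd_imp_le[of "int p ^ r" j] by (auto simp: sum_ramanujan_sum[OF p])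
  finally show "(\<Sum>i\<in>{..r} \<times> ?A. 1 * (case i of (k, \<psi>) \<Rightarrow> induced_char p r k \<psi>) g) =
      (if g = \<one>\<^bsub>K_group p r\<^esub> then of_nat (?n * p ^ r) else 0)"
    by (simp add: js(1) K_group_one[OF p r])
qed

lemma linear_chars_eq: "linear_chars p r = induced_char p r 0 ` carrier (char_group (G_group p r))"
  unfolding linear_chars_def induced_char_def by simp

lemma twisted_chars_eq:
  assumes "1 \<le> k" "k \<le> r"
  shows "twisted_chars p r k T = induced_char p r k ` T"
proof -
  have "(\<lambda>(j, \<sigma>). \<psi> \<sigma> * chi p r k (j, \<sigma>)) =
      (\<lambda>(j, \<sigma>). if int p ^ k dvd \<sigma> - 1 then \<psi> \<sigma> * ramanujan_sum p k j else 0)" for \<psi> :: "int \<Rightarrow> complex"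
    by (auto simp: fun_eq_iff chi_eq_ramanujan_sum[OF p assms])
  then show ?thesis unfolding twisted_chars_def induced_char_def by simp
qed

lemma ramanujan_sum_zero_neq_0: "ramanujan_sum p k 0 \<noteq> 0"
proof -
  have "coprime_residues p k \<noteq> {}"
  proof (cases "k = 0")
    case False
    then have "1 \<in> coprime_residues p k"
      using one_less_prime_power[OF p, of k] by (simp add: coprime_residues_def)
    then show ?thesis by blast
  qed simp
  then show ?thesis by (simp add: ramanujan_sum_def unit_exp_def card_gt_0_iff)
qed

lemma induced_char_eq_iff:
  assumes "k \<le> r"
  shows "induced_char p r k \<psi> = induced_char p r k \<psi>' \<longleftrightarrow>
    (\<forall>\<sigma>\<in>coprime_residues p r. int p ^ k dvd \<sigma> - 1 \<longrightarrow> \<psi> \<sigma> = \<psi>' \<sigma>)"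
proof
  assume eq: "induced_char p r k \<psi> = induced_char p r k \<psi>'"
  show "\<forall>\<sigma>\<in>coprime_residues p r. int p ^ k dvd \<sigma> - 1 \<longrightarrow> \<psi> \<sigma> = \<psi>' \<sigma>"
  proof (intro ballI impI)
    fix \<sigma> assume s: "\<sigma> \<in> coprime_residues p r" "int p ^ k dvd \<sigma> - 1"
    then have "(0, \<sigma>) \<in> carrier (K_group p r)"
      using prime_gt_0_nat[OF p] by (simp add: carrier_K_group[OF p r])
    with fun_cong[OF eq, of "(0, \<sigma>)"] s show "\<psi> \<sigma> = \<psi>' \<sigma>"
      by (simp add: induced_char_def ramanujan_sum_zero_neq_0)
  qed
next
  assume "\<forall>\<sigma>\<in>coprime_residues p r. int p ^ k dvd \<sigma> - 1 \<longrightarrow> \<psi> \<sigma> = \<psi>' \<sigma>"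
  then show "induced_char p r k \<psi> = induced_char p r k \<psi>'"
    unfolding induced_char_def by (intro restrict_ext) (auto simp: carrier_K_group[OF p r])
qed

context
  fixes k :: nat
  assumes k: "1 \<le> k" "k \<le> r"
begin

lemma coprime_residues_mono: "coprime_residues p k \<subseteq> coprime_residues p r"
proof
  fix x assume x: "x \<in> coprime_residues p k"
  then have "coprime x (int p ^ k)" by (simp add: coprime_residues_def)
  then have "coprime x (int p)" using k coprime_power_right_iff[of x "int p" k] by simp
  then have "coprime x (int p ^ r)" by simp
  moreover have "int p ^ k \<le> int p ^ r"
    using k(2) prime_gt_0_nat[OF p] by (intro power_increasing) auto
  ultimately show "x \<in> coprime_residues p r"
    using x unfolding coprime_residues_def mem_Collect_eq atLeastLessThan_iff by linarith
qed

lemma mod_coprime_residues: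
  assumes "x \<in> coprime_residues p r"
  shows "x mod int p ^ k \<in> coprime_residues p k"
proof -
  have pos: "int p ^ k > 0" using prime_gt_0_nat[OF p] by simp
  have "coprime x (int p ^ k)" by (rule coprime_residues_coprime[OF k(2) assms])
  then show ?thesis
    using pos pos_mod_bound[OF pos, of x] pos_mod_sign[OF pos, of x]
    unfolding coprime_residues_def mem_Collect_eq atLeastLessThan_iff
    by (metis coprime_mod_left_iff less_irrefl)
qed

lemma mod_mod_power: "x mod int p ^ r mod int p ^ k = x mod int p ^ k"
  using k(2) by (intro mod_mod_cancel le_imp_power_dvd)

definition inflate :: "(int \<Rightarrow> complex) \<Rightarrow> int \<Rightarrow> complex" where
  "inflate \<phi> = (\<lambda>\<sigma>\<in>carrier (G_group p r). \<phi> (\<sigma> mod int p ^ k))"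

lemma inflated_chars_eq: "inflated_chars p r k = inflate ` carrier (char_group (G_group p k))"
  unfolding inflated_chars_def inflate_def by auto

lemma inflate_char_group:
  assumes \<phi>: "\<phi> \<in> carrier (char_group (G_group p k))"
  shows "inflate \<phi> \<in> carrier (char_group (G_group p r))"
proof -
  interpret G: group "G_group p r" by (rule group_G_group[OF p r])
  have cl: "x * y mod int p ^ r \<in> coprime_residues p r"
    if "x \<in> coprime_residues p r" "y \<in> coprime_residues p r" for x y
    using G.m_closed that by (simp add: carrier_G_group[OF p r] G_group_mult[OF p r])
  have nz: "\<phi> x \<noteq> 0" if "x \<in> coprime_residues p k" for x
    using \<phi> that unfolding char_group_carrier_iff carrier_G_group[OF p k(1)] by blast
  have mult: "\<phi> (x * y mod int p ^ k) = \<phi> x * \<phi> y"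
    if "x \<in> coprime_residues p k" "y \<in> coprime_residues p k" for x y
    using \<phi> that unfolding char_group_carrier_iff carrier_G_group[OF p k(1)] G_group_mult[OF p k(1)] by blast
  have "\<phi> (x * y mod int p ^ k) = \<phi> (x mod int p ^ k) * \<phi> (y mod int p ^ k)"
    if "x \<in> coprime_residues p r" "y \<in> coprime_residues p r" for x y
    using mult[OF mod_coprime_residues[OF that(1)] mod_coprime_residues[OF that(2)]]
    by (simp add: mod_mult_eq)
  then show ?thesis
    unfolding char_group_carrier_iff inflate_def carrier_G_group[OF p r] G_group_mult[OF p r]
    using nz[OF mod_coprime_residues] by (simp add: cl mod_mod_power)
qed

lemma inj_on_inflate: "inj_on inflate (carrier (char_group (G_group p k)))"
proof (rule inj_onI)
  fix \<phi> \<phi>' assume \<phi>: "\<phi> \<in> carrier (char_group (G_group p k))" "\<phi>' \<in> carrier (char_group (G_group p k))"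
    and eq: "inflate \<phi> = inflate \<phi>'"
  have ext: "\<phi> \<in> extensional (coprime_residues p k)" "\<phi>' \<in> extensional (coprime_residues p k)"
    using \<phi> by (simp_all add: char_group_carrier_iff carrier_G_group[OF p k(1)])
  show "\<phi> = \<phi>'"
  proof (rule extensionalityI[OF ext])
    fix x assume x: "x \<in> coprime_residues p k"
    then have "x mod int p ^ k = x" by (simp add: coprime_residues_def)
    with fun_cong[OF eq, of x] x coprime_residues_mono show "\<phi> x = \<phi>' x"
      by (auto simp: inflate_def carrier_G_group[OF p r])
  qed
qed

lemma card_inflated_chars: "card (inflated_chars p r k) = p ^ (k - 1) * (p - 1)"
  unfolding inflated_chars_eq card_image[OF inj_on_inflate] by (rule card_char_group_G_group[OF p k(1) odd])

lemma inflated_chars_iff: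
  "\<eta> \<in> inflated_chars p r k \<longleftrightarrow> \<eta> \<in> carrier (char_group (G_group p r)) \<and>
     (\<forall>\<sigma>\<in>coprime_residues p r. int p ^ k dvd \<sigma> - 1 \<longrightarrow> \<eta> \<sigma> = 1)"
proof (intro iffI conjI ballI impI)
  assume "\<eta> \<in> inflated_chars p r k"
  then obtain \<phi> where \<phi>: "\<phi> \<in> carrier (char_group (G_group p k))" "\<eta> = inflate \<phi>"
    by (auto simp: inflated_chars_eq)
  then show "\<eta> \<in> carrier (char_group (G_group p r))" by (simp add: inflate_char_group)
  fix \<sigma> assume s: "\<sigma> \<in> coprime_residues p r" "int p ^ k dvd \<sigma> - 1"
  have "\<sigma> mod int p ^ k = 1 mod int p ^ k" by (rule mod_eq_dvd_iff[THEN iffD2, OF s(2)])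
  also have "\<dots> = 1"
    by (rule mod_pos_pos_trivial[OF _ one_less_prime_power[OF p k(1)]]) simp
  finally have "\<sigma> mod int p ^ k = 1" .
  then show "\<eta> \<sigma> = 1"
    using s char_group_one[OF group_G_group[OF p k(1)] \<phi>(1)]
    by (simp add: \<phi>(2) inflate_def carrier_G_group[OF p r] G_group_one[OF p k(1)])
next
  assume A: "\<eta> \<in> carrier (char_group (G_group p r)) \<and>
    (\<forall>\<sigma>\<in>coprime_residues p r. int p ^ k dvd \<sigma> - 1 \<longrightarrow> \<eta> \<sigma> = 1)"
  interpret G: group "G_group p r" by (rule group_G_group[OF p r])
  interpret Gk: group "G_group p k" by (rule group_G_group[OF p k(1)])
  have mult: "\<eta> (x * y mod int p ^ r) = \<eta> x * \<eta> y"
    if "x \<in> coprime_residues p r" "y \<in> coprime_residues p r" for x y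
    using A that unfolding char_group_carrier_iff carrier_G_group[OF p r] G_group_mult[OF p r] by blast
  have nz: "\<eta> x \<noteq> 0" if "x \<in> coprime_residues p r" for x
    using A that unfolding char_group_carrier_iff carrier_G_group[OF p r] by blast
  have cong: "\<eta> x = \<eta> y"
    if xy: "x \<in> coprime_residues p r" "y \<in> coprime_residues p r" "x mod int p ^ k = y mod int p ^ k" for x y
  proof -
    define z where "z = inv\<^bsub>G_group p r\<^esub> y"
    have z: "z \<in> coprime_residues p r" "y * z mod int p ^ r = 1"
      using G.r_inv[of y] G.inv_closed[of y] xy(2)
      by (simp_all add: z_def carrier_G_group[OF p r] G_group_mult[OF p r] G_group_one[OF p r])
    have "x * z mod int p ^ r mod int p ^ k = y * z mod int p ^ r mod int p ^ k"
      unfolding mod_mod_power using xy(3) by (metis mod_mult_left_eq)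
    then have "int p ^ k dvd x * z mod int p ^ r - 1" unfolding z(2) by (simp add: mod_eq_dvd_iff)
    moreover have "x * z mod int p ^ r \<in> coprime_residues p r"
      using G.m_closed[of x z] xy z by (simp add: carrier_G_group[OF p r] G_group_mult[OF p r])
    ultimately have "\<eta> (x * z mod int p ^ r) = 1" using A by blast
    then have "\<eta> x * \<eta> z = 1" using mult xy z by simp
    moreover have "\<eta> y * \<eta> z = 1"
      using mult[OF xy(2) z(1)] char_group_one[OF G.group_axioms, of \<eta>] A
      by (simp add: z(2) G_group_one[OF p r])
    ultimately show ?thesis using nz[OF z(1)] by (metis mult_right_cancel)
  qed
  define \<phi> where "\<phi> = restrict \<eta> (coprime_residues p k)"
  have "\<eta> (x * y mod int p ^ k) = \<eta> x * \<eta> y"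
    if "x \<in> coprime_residues p k" "y \<in> coprime_residues p k" for x y
  proof -
    have xy: "x \<in> coprime_residues p r" "y \<in> coprime_residues p r"
      using that coprime_residues_mono by auto
    have "x * y mod int p ^ k \<in> coprime_residues p r"
      using Gk.m_closed[of x y] that coprime_residues_mono
      by (auto simp: carrier_G_group[OF p k(1)] G_group_mult[OF p k(1)])
    moreover have "x * y mod int p ^ r \<in> coprime_residues p r"
      using G.m_closed[of x y] xy by (simp add: carrier_G_group[OF p r] G_group_mult[OF p r])
    ultimately have "\<eta> (x * y mod int p ^ k) = \<eta> (x * y mod int p ^ r)"
      by (rule cong) (simp add: mod_mod_power)
    then show ?thesis using mult[OF xy] by simp
  qed
  moreover have "x * y mod int p ^ k \<in> coprime_residues p k"
    if "x \<in> coprime_residues p k" "y \<in> coprime_residues p k" for x y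
    using Gk.m_closed[of x y] that by (simp add: carrier_G_group[OF p k(1)] G_group_mult[OF p k(1)])
  moreover have "\<eta> x \<noteq> 0" if "x \<in> coprime_residues p k" for x
    using nz that coprime_residues_mono by blast
  ultimately have "\<phi> \<in> carrier (char_group (G_group p k))"
    unfolding char_group_carrier_iff \<phi>_def carrier_G_group[OF p k(1)] G_group_mult[OF p k(1)] by simp
  moreover have "inflate \<phi> = \<eta>"
  proof (rule extensionalityI[of _ "coprime_residues p r"])
    show "inflate \<phi> \<in> extensional (coprime_residues p r)"
      by (simp add: inflate_def carrier_G_group[OF p r])
    show "\<eta> \<in> extensional (coprime_residues p r)"
      using A by (simp add: char_group_carrier_iff carrier_G_group[OF p r])
    fix x assume x: "x \<in> coprime_residues p r"
    have "\<eta> (x mod int p ^ k) = \<eta> x"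
      using mod_coprime_residues[OF x] coprime_residues_mono x by (intro cong) auto
    then show "inflate \<phi> x = \<eta> x"
      using x mod_coprime_residues[OF x] by (simp add: inflate_def \<phi>_def carrier_G_group[OF p r])
  qed
  ultimately show "\<eta> \<in> inflated_chars p r k" unfolding inflated_chars_eq by blast
qed

lemma subgroup_inflated_chars: "subgroup (inflated_chars p r k) (char_group (G_group p r))"
proof -
  interpret A: comm_group "char_group (G_group p r)"
    by (rule comm_group_char_group[OF group_G_group[OF p r]])
  have val: "(\<phi> \<otimes>\<^bsub>char_group (G_group p r)\<^esub> \<psi>) x = \<phi> x * \<psi> x" "\<one>\<^bsub>char_group (G_group p r)\<^esub> x = 1"
    if "x \<in> coprime_residues p r" for \<phi> \<psi> x
    using that by (simp_all add: char_group_def carrier_G_group[OF p r])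
  have inv: "(inv\<^bsub>char_group (G_group p r)\<^esub> \<psi>) x = inverse (\<psi> x)"
    if "\<psi> \<in> carrier (char_group (G_group p r))" "x \<in> coprime_residues p r" for \<psi> x
    using that char_group_inv[OF group_G_group[OF p r]] by (simp add: carrier_G_group[OF p r])
  show ?thesis
  proof (rule A.subgroupI)
    show "inflated_chars p r k \<subseteq> carrier (char_group (G_group p r))"
      by (auto simp: inflated_chars_iff)
    have "\<one>\<^bsub>char_group (G_group p r)\<^esub> \<in> inflated_chars p r k"
      by (simp add: inflated_chars_iff val)
    then show "inflated_chars p r k \<noteq> {}" by blast
    show "inv\<^bsub>char_group (G_group p r)\<^esub> \<psi> \<in> inflated_chars p r k" if "\<psi> \<in> inflated_chars p r k" for \<psi>
      using that by (auto simp: inflated_chars_iff inv)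
    show "\<phi> \<otimes>\<^bsub>char_group (G_group p r)\<^esub> \<psi> \<in> inflated_chars p r k"
      if "\<phi> \<in> inflated_chars p r k" "\<psi> \<in> inflated_chars p r k" for \<phi> \<psi>
      using that by (auto simp: inflated_chars_iff val)
  qed
qed

lemma inflated_coset_iff:
  assumes "\<psi> \<in> carrier (char_group (G_group p r))" "\<psi>' \<in> carrier (char_group (G_group p r))"
  shows "\<psi>' \<in> inflated_chars p r k #>\<^bsub>char_group (G_group p r)\<^esub> \<psi> \<longleftrightarrow>
     induced_char p r k \<psi>' = induced_char p r k \<psi>"
proof -
  interpret A: comm_group "char_group (G_group p r)"
    by (rule comm_group_char_group[OF group_G_group[OF p r]])
  have "(\<psi>' \<otimes>\<^bsub>char_group (G_group p r)\<^esub> inv\<^bsub>char_group (G_group p r)\<^esub> \<psi>) \<sigma> = 1 \<longleftrightarrow> \<psi>' \<sigma> = \<psi> \<sigma>"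
    if s: "\<sigma> \<in> coprime_residues p r" for \<sigma>
  proof -
    have "(\<psi>' \<otimes>\<^bsub>char_group (G_group p r)\<^esub> inv\<^bsub>char_group (G_group p r)\<^esub> \<psi>) \<sigma> =
        \<psi>' \<sigma> * (inv\<^bsub>char_group (G_group p r)\<^esub> \<psi>) \<sigma>"
      using s by (simp add: char_group_def carrier_G_group[OF p r])
    also have "\<dots> = \<psi>' \<sigma> * inverse (\<psi> \<sigma>)"
      using s char_group_inv[OF group_G_group[OF p r] assms(1)] by (simp add: carrier_G_group[OF p r])
    finally have "(\<psi>' \<otimes>\<^bsub>char_group (G_group p r)\<^esub> inv\<^bsub>char_group (G_group p r)\<^esub> \<psi>) \<sigma> =
        \<psi>' \<sigma> / \<psi> \<sigma>" by (simp only: divide_inverse)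
    moreover have "\<psi> \<sigma> \<noteq> 0"
      using assms(1) s by (simp add: char_group_carrier_iff carrier_G_group[OF p r])
    ultimately show ?thesis by (simp add: right_inverse_eq)
  qed
  then show ?thesis
    unfolding subgroup.rcos_module[OF subgroup_inflated_chars A.group_axioms assms]
      inflated_chars_iff induced_char_eq_iff[OF k(2)]
    using assms by auto
qed

context
  fixes T :: "(int \<Rightarrow> complex) set"
  assumes T: "coset_representatives (char_group (G_group p r)) (inflated_chars p r k) T"
begin

lemma representatives_subset: "T \<subseteq> carrier (char_group (G_group p r))"
  using T by (simp add: coset_representatives_def)

lemma induced_char_image_representatives:
  "induced_char p r k ` T = induced_char p r k ` carrier (char_group (G_group p r))"
proof (intro equalityI subsetI)
  interpret A: comm_group "char_group (G_group p r)"
    by (rule comm_group_char_group[OF group_G_group[OF p r]])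
  show "\<theta> \<in> induced_char p r k ` carrier (char_group (G_group p r))" if "\<theta> \<in> induced_char p r k ` T" for \<theta>
    using that representatives_subset by blast
  fix \<theta> assume "\<theta> \<in> induced_char p r k ` carrier (char_group (G_group p r))"
  then obtain \<psi> where \<psi>: "\<psi> \<in> carrier (char_group (G_group p r))" "\<theta> = induced_char p r k \<psi>" by blast
  then have "inflated_chars p r k #>\<^bsub>char_group (G_group p r)\<^esub> \<psi> \<in>
      rcosets\<^bsub>char_group (G_group p r)\<^esub> inflated_chars p r k"
    by (intro A.rcosetsI subgroup.subset[OF subgroup_inflated_chars])
  then obtain t where t: "t \<in> T" "t \<in> inflated_chars p r k #>\<^bsub>char_group (G_group p r)\<^esub> \<psi>"
    using T unfolding coset_representatives_def by blast
  then have "induced_char p r k t = \<theta>"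
    using inflated_coset_iff[OF \<psi>(1)] representatives_subset \<psi>(2) by blast
  then show "\<theta> \<in> induced_char p r k ` T" using t(1) by blast
qed

lemma inj_on_induced_char_representatives: "inj_on (induced_char p r k) T"
proof (rule inj_onI)
  interpret A: comm_group "char_group (G_group p r)"
    by (rule comm_group_char_group[OF group_G_group[OF p r]])
  fix t u assume tu: "t \<in> T" "u \<in> T" and eq: "induced_char p r k t = induced_char p r k u"
  have car: "t \<in> carrier (char_group (G_group p r))" "u \<in> carrier (char_group (G_group p r))"
    using tu representatives_subset by auto
  then have "t \<in> inflated_chars p r k #>\<^bsub>char_group (G_group p r)\<^esub> u"
    using inflated_coset_iff[OF car(2,1)] eq by blast
  then have "inflated_chars p r k #>\<^bsub>char_group (G_group p r)\<^esub> u =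
      inflated_chars p r k #>\<^bsub>char_group (G_group p r)\<^esub> t"
    by (rule A.repr_independence[OF _ car(2) subgroup_inflated_chars])
  then show "t = u"
    using coset_representatives_bij_betw[OF A.group_axioms subgroup_inflated_chars T] tu
    by (metis bij_betw_imp_inj_on inj_onD)
qed

lemma card_representatives: "card T = p ^ (r - k)"
proof -
  interpret A: comm_group "char_group (G_group p r)"
    by (rule comm_group_char_group[OF group_G_group[OF p r]])
  have "card T * card (inflated_chars p r k) = Coset.order (char_group (G_group p r))"
    using A.lagrange[OF subgroup_inflated_chars]
      bij_betw_same_card[OF coset_representatives_bij_betw[OF A.group_axioms subgroup_inflated_chars T]]
    by simp
  then have "card T * (p ^ (k - 1) * (p - 1)) = p ^ (r - 1) * (p - 1)"
    by (simp add: card_inflated_chars Coset.order_def card_char_group_G_group[OF p r odd])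
  also have "p ^ (r - 1) = p ^ (r - k) * p ^ (k - 1)"
    using k by (simp flip: power_add)
  finally have "card T * (p ^ (k - 1) * (p - 1)) = p ^ (r - k) * (p ^ (k - 1) * (p - 1))"
    by (simp only: mult.assoc)
  moreover have "p ^ (k - 1) * (p - 1) \<noteq> 0" using prime_gt_1_nat[OF p] by simp
  ultimately show ?thesis by (simp only: mult_cancel2 simp_thms)
qed

end

end

lemma inj_on_induced_char_0: "inj_on (induced_char p r 0) (carrier (char_group (G_group p r)))"
proof (rule inj_onI)
  fix \<phi> \<psi> assume A: "\<phi> \<in> carrier (char_group (G_group p r))" "\<psi> \<in> carrier (char_group (G_group p r))"
    and eq: "induced_char p r 0 \<phi> = induced_char p r 0 \<psi>"
  have "\<phi> \<sigma> = \<psi> \<sigma>" if "\<sigma> \<in> coprime_residues p r" for \<sigma>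
    using eq that unfolding induced_char_eq_iff[OF le0] by simp
  moreover have "\<phi> \<in> extensional (coprime_residues p r)" "\<psi> \<in> extensional (coprime_residues p r)"
    using A by (simp_all add: char_group_carrier_iff carrier_G_group[OF p r])
  ultimately show "\<phi> = \<psi>" by (rule extensionalityI[rotated 2])
qed

end

theorem theorem3p7:
  fixes p r :: nat and T :: "nat \<Rightarrow> (int \<Rightarrow> complex) set"
  assumes "prime p" and "odd p" and "r \<ge> 1"
    and "\<And>k. k \<in> {1..r} \<Longrightarrow>
           coset_representatives (char_group (G_group p r)) (inflated_chars p r k) (T k)"
  shows "irreducible_characters (K_group p r) =
           linear_chars p r \<union> (\<Union>k\<in>{1..r}. twisted_chars p r k (T k)) \<and>
         card (linear_chars p r) = p ^ (r - 1) * (p - 1) \<and>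
         (\<forall>\<theta>\<in>linear_chars p r. char_degree (K_group p r) \<theta> = 1) \<and>
         (\<forall>k\<in>{1..r}.
            card (twisted_chars p r k (T k)) = p ^ (r - k) \<and>
            (\<forall>\<theta>\<in>twisted_chars p r k (T k).
               char_degree (K_group p r) \<theta> = p ^ (k - 1) * (p - 1)))"
proof (intro conjI ballI)
  note pr = assms(1-3)
  let ?A = "carrier (char_group (G_group p r))"
  have tw: "twisted_chars p r k (T k) = induced_char p r k ` T k" if "k \<in> {1..r}" for k
    using that by (intro twisted_chars_eq[OF pr]) auto
  have tw_all: "twisted_chars p r k (T k) = induced_char p r k ` ?A" if "k \<in> {1..r}" for k
    unfolding tw[OF that] using that
    by (intro induced_char_image_representatives[OF pr _ _ assms(4)]) auto
  have "irreducible_characters (K_group p r) = (\<Union>k\<in>{..r}. induced_char p r k ` ?A)"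
    unfolding irreducible_characters_K_group[OF pr] by auto
  also have "{..r} = insert 0 {1..r}" by auto
  also have "(\<Union>k\<in>insert 0 {1..r}. induced_char p r k ` ?A) =
      linear_chars p r \<union> (\<Union>k\<in>{1..r}. twisted_chars p r k (T k))"
    using tw_all by (simp add: linear_chars_eq[OF pr])
  finally show "irreducible_characters (K_group p r) =
      linear_chars p r \<union> (\<Union>k\<in>{1..r}. twisted_chars p r k (T k))" .
  show "card (linear_chars p r) = p ^ (r - 1) * (p - 1)"
    unfolding linear_chars_eq[OF pr] card_image[OF inj_on_induced_char_0[OF pr]]
    by (rule card_char_group_G_group[OF assms(1,3,2)])
  show "char_degree (K_group p r) \<theta> = 1" if "\<theta> \<in> linear_chars p r" for \<theta>
    using that char_degree_induced_char[OF pr le0] by (auto simp: linear_chars_eq[OF pr])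
  fix k assume k: "k \<in> {1..r}"
  then have k': "1 \<le> k" "k \<le> r" by auto
  show "card (twisted_chars p r k (T k)) = p ^ (r - k)"
    unfolding tw[OF k] card_image[OF inj_on_induced_char_representatives[OF pr k' assms(4)[OF k]]]
    by (rule card_representatives[OF pr k' assms(4)[OF k]])
  show "char_degree (K_group p r) \<theta> = p ^ (k - 1) * (p - 1)" if "\<theta> \<in> twisted_chars p r k (T k)" for \<theta>
    using that char_degree_induced_char[OF pr k'(2)] card_coprime_residues[OF assms(1) k'(1)]
    unfolding tw_all[OF k] by auto
qed

end
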